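(* Let $n\in\mathbb{N}$, $n\ge 1$, $0<\alpha\le 1$, and let $\gamma_1,\dots,\gamma_n\in\mathbb{R}$. Put $s_k:=\sum_{i=1}^k\gamma_i$ for $k=1,\dots,n$, and assume that $\gamma_k\ge 0$ and $\alpha+s_k\le k$ for all $k=1,\dots,n$, that $n-1<\alpha+s_n$, and that $\gamma_k<1$ for $k=2,\dots,n$. Let $D^{\alpha,(\gamma)}_{nL}$ be the $n$th level fractional derivative of order $\alpha$ and type $\gamma=(\gamma_1,\dots,\gamma_n)$ on $[0,1]$, and let $X_{nL}$ be its domain (both defined in the context). Then for every $f\in X_{nL}$ the projector $$(P^\alpha_{nL} f)(x) := f(x)-(I^{\alpha} D^{\alpha,(\gamma)}_{nL} f)(x)$$ takes the form $$(P^\alpha_{nL} f)(x)=\sum_{k=1}^n p_k\, x^{\sigma_k},\qquad \sigma_k=\alpha+s_k-k,$$ where $$p_k=\frac{\left(\prod_{i=k+1}^n\left(I^{\gamma_i}\frac{d}{dx}\right) I^{n-\alpha-s_n} f\right)(0)}{\Gamma(\alpha+s_k-k+1)},\qquad k=1,\dots,n.$$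
   Context: For $\beta\ge 0$, $I^\beta$ is the Riemann-Liouville fractional integral on $[0,1]$: $(I^\beta f)(x)=\frac{1}{\Gamma(\beta)}\int_0^x (x-t)^{\beta-1}f(t)\,dt$ for $\beta>0$, and $I^0 f=f$. Products of operators are ordered compositions with the smallest index leftmost (applied last): $\prod_{k=i}^n (I^{\gamma_k}\frac{d}{dx}) = I^{\gamma_i}\frac{d}{dx}\, I^{\gamma_{i+1}}\frac{d}{dx}\cdots I^{\gamma_n}\frac{d}{dx}$; an empty product is the identity operator. The $n$th level fractional derivative of order $\alpha$ and type $\gamma=(\gamma_1,\dots,\gamma_n)$ is $$(D^{\alpha,(\gamma)}_{nL} f)(x)=\left(\prod_{k=1}^n \left(I^{\gamma_k}\frac{d}{dx}\right)\right)(I^{n-\alpha-s_n}f)(x).$$ Its domain is $$X_{nL}=\left\{f:\ \left(\prod_{k=i}^n \left(I^{\gamma_k}\tfrac{d}{dx}\right)\right) I^{n-\alpha-s_n}f\in \mathrm{AC}([0,1]),\ i=2,\dots,n+1\right\},$$ where $\mathrm{AC}([0,1])$ is the space of absolutely continuous functions. Here $f$ is understood to be an (integrable) function on $(0,1)$, functions being identified when equal almost everywhere, so that values at $0$ of the AC functions above are those of the continuous representative, and identities between functions hold almost everywhere. The derivative of $h\in \mathrm{AC}([0,1])$ with $h(x)=h(0)+\int_0^x\phi(t)\,dt$, $\phi\in L_1(0,1)$, is $\frac{dh}{dx}:=\phi$. The operator $D^{\alpha,(\gamma)}_{nL}$ maps $X_{nL}$ into $L_1(0,1)$. *)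

theory Defs
  imports "HOL-Analysis.Analysis"
begin

text \<open>
  Elements of \<open>L\<^sub>1(0,1)\<close> are represented by functions \<^typ>\<open>real \<Rightarrow> real\<close> whose values
  outside the interval are irrelevant; equality of classes is equality almost everywhere on
  \<^term>\<open>{0<..<1::real}\<close>.
\<close>

definition L1 :: "(real \<Rightarrow> real) set" where
  "L1 = {f. set_integrable lebesgue {0<..<1} f}"

text \<open>The junk value for \<open>\<beta> < 0\<close> is never used below.\<close>

definition RL_integral :: "real \<Rightarrow> (real \<Rightarrow> real) \<Rightarrow> real \<Rightarrow> real" where
  "RL_integral \<beta> f x =
     (if \<beta> = 0 then f x
      else 1 / Gamma \<beta> * (LINT t:{0..x}|lebesgue. (x - t) powr (\<beta> - 1) * f t))"

text \<open>
  Absolute continuity of a function (the library's \<^const>\<open>absolutely_continuous\<close> is about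
  measures). A finite family of intervals is given by the set of its pairs of endpoints.
\<close>

definition absolutely_continuous_fun_on :: "real \<Rightarrow> real \<Rightarrow> (real \<Rightarrow> real) \<Rightarrow> bool" where
  "absolutely_continuous_fun_on a b g \<longleftrightarrow>
     (\<forall>\<epsilon>>0. \<exists>\<delta>>0. \<forall>I :: (real \<times> real) set.
        finite I \<longrightarrow>
        (\<forall>(u, v)\<in>I. a \<le> u \<and> u < v \<and> v \<le> b) \<longrightarrow>
        disjoint_family_on (\<lambda>(u, v). {u<..<v}) I \<longrightarrow>
        (\<Sum>(u, v)\<in>I. v - u) < \<delta> \<longrightarrow>
        (\<Sum>(u, v)\<in>I. \<bar>g v - g u\<bar>) < \<epsilon>)"

definition is_AC_representative :: "(real \<Rightarrow> real) \<Rightarrow> (real \<Rightarrow> real) \<Rightarrow> bool" where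
  "is_AC_representative h g \<longleftrightarrow>
     absolutely_continuous_fun_on 0 1 g \<and> (AE x\<in>{0<..<1} in lebesgue. h x = g x)"

text \<open>
  Membership of the almost-everywhere class of \<open>h\<close> in \<open>AC([0,1])\<close>. The representative is
  unique on \<^term>\<open>{0..1::real}\<close>, so the choice below is immaterial there.
\<close>

definition AC :: "(real \<Rightarrow> real) set" where
  "AC = {h. \<exists>g. is_AC_representative h g}"

definition AC_representative :: "(real \<Rightarrow> real) \<Rightarrow> real \<Rightarrow> real" where
  "AC_representative h = (SOME g. is_AC_representative h g)"

text \<open>
  The derivative of \<open>h \<in> AC\<close> is the \<open>\<phi> \<in> L1\<close>, unique almost everywhere on
  \<^term>\<open>{0<..<1::real}\<close>, with \<open>h(x) = h(0) + \<integral>\<^sub>0\<^sup>x \<phi>\<close> for the continuous representative.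
\<close>

definition AC_deriv :: "(real \<Rightarrow> real) \<Rightarrow> real \<Rightarrow> real" where
  "AC_deriv h = (SOME \<phi>. \<phi> \<in> L1 \<and>
     (\<forall>x\<in>{0..1}. AC_representative h x =
        AC_representative h 0 + (LINT t:{0..x}|lebesgue. \<phi> t)))"

text \<open>The ordered composition for \<open>k = i, \<dots>, n\<close>, with index \<open>n\<close> applied first; the identity if \<open>i > n\<close>.\<close>

definition RL_deriv_prod :: "(nat \<Rightarrow> real) \<Rightarrow> nat \<Rightarrow> nat \<Rightarrow> (real \<Rightarrow> real) \<Rightarrow> real \<Rightarrow> real" where
  "RL_deriv_prod \<gamma> i n = foldr (\<lambda>k h. RL_integral (\<gamma> k) (AC_deriv h)) [i..<Suc n]"

text \<open>Only \<open>\<gamma> 1, \<dots>, \<gamma> n\<close> matter.\<close>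

definition partial_type_sum :: "(nat \<Rightarrow> real) \<Rightarrow> nat \<Rightarrow> real" where
  "partial_type_sum \<gamma> k = (\<Sum>i=1..k. \<gamma> i)"

definition inner_integral :: "nat \<Rightarrow> real \<Rightarrow> (nat \<Rightarrow> real) \<Rightarrow> (real \<Rightarrow> real) \<Rightarrow> real \<Rightarrow> real" where
  "inner_integral n \<alpha> \<gamma> f = RL_integral (real n - \<alpha> - partial_type_sum \<gamma> n) f"

definition nL_derivative :: "nat \<Rightarrow> real \<Rightarrow> (nat \<Rightarrow> real) \<Rightarrow> (real \<Rightarrow> real) \<Rightarrow> real \<Rightarrow> real" where
  "nL_derivative n \<alpha> \<gamma> f = RL_deriv_prod \<gamma> 1 n (inner_integral n \<alpha> \<gamma> f)"

definition nL_domain :: "nat \<Rightarrow> real \<Rightarrow> (nat \<Rightarrow> real) \<Rightarrow> (real \<Rightarrow> real) set" where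
  "nL_domain n \<alpha> \<gamma> =
     {f \<in> L1. \<forall>i\<in>{2..n + 1}. RL_deriv_prod \<gamma> i n (inner_integral n \<alpha> \<gamma> f) \<in> AC}"

definition nL_projector :: "nat \<Rightarrow> real \<Rightarrow> (nat \<Rightarrow> real) \<Rightarrow> (real \<Rightarrow> real) \<Rightarrow> real \<Rightarrow> real" where
  "nL_projector n \<alpha> \<gamma> f x = f x - RL_integral \<alpha> (nL_derivative n \<alpha> \<gamma> f) x"

definition nL_exponent :: "real \<Rightarrow> (nat \<Rightarrow> real) \<Rightarrow> nat \<Rightarrow> real" where
  "nL_exponent \<alpha> \<gamma> k = \<alpha> + partial_type_sum \<gamma> k - real k"

definition nL_coefficient ::
    "nat \<Rightarrow> real \<Rightarrow> (nat \<Rightarrow> real) \<Rightarrow> (real \<Rightarrow> real) \<Rightarrow> nat \<Rightarrow> real" where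
  "nL_coefficient n \<alpha> \<gamma> f k =
     AC_representative (RL_deriv_prod \<gamma> (k + 1) n (inner_integral n \<alpha> \<gamma> f)) 0
       / Gamma (\<alpha> + partial_type_sum \<gamma> k - real k + 1)"

end

theory Submission
  imports Defs
begin

text \<open>
  Write \<open>h\<^sub>k\<close> for the product of the factors \<open>k, \<dots>, n\<close> applied to \<open>I\<^sup>b f\<close> with \<open>b = n - \<alpha> - s\<^sub>n\<close>, and
  \<open>b\<^sub>k = k - \<alpha> - s\<^sub>k\<close>. The hypotheses on \<open>\<gamma>\<close> give \<open>b\<^sub>k < 1\<close>, so \<open>I\<close> of order \<open>1 - b\<^sub>k\<close> may be
  applied to \<open>h\<^sub>k\<^sub>+\<^sub>1(x) = h\<^sub>k\<^sub>+\<^sub>1(0) + \<integral>\<^sub>0\<^sup>x h\<^sub>k\<^sub>+\<^sub>1'\<close>; the semigroup law turns the result into a power of \<open>x\<close> plus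
  \<open>I\<close> of order \<open>1 - b\<^sub>k\<^sub>-\<^sub>1\<close> applied to \<open>h\<^sub>k\<close>. The sum over \<open>k\<close> telescopes to an identity between \<open>I\<^sup>1 f\<close>
  and \<open>I\<^sup>1 I\<^sup>\<alpha> h\<^sub>1\<close>, which is differentiated at the end. All compositions that occur have total order at least
  \<open>1\<close>, so the semigroup law is only needed in the pointwise form.

  The fundamental theorem of calculus for absolutely continuous functions is obtained by splitting
  into monotone parts with the positive variation and applying the Radon-Nikodym theorem to the
  associated Stieltjes measures.
\<close>

section \<open>Absolutely continuous functions\<close>

definition interval_families :: "real \<Rightarrow> real \<Rightarrow> (real \<times> real) set set" where
  "interval_families a b = {I. finite I \<and> (\<forall>(u, v)\<in>I. a \<le> u \<and> u < v \<and> v \<le> b) \<and>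
     disjoint_family_on (\<lambda>(u, v). {u<..<v}) I}"

text \<open>The increments keep their sign: cutting an interval at an inner point then leaves the
  sum unchanged, and the supremum over families, which may skip stretches where \<open>g\<close>
  falls, is the positive variation and not the total one.\<close>

definition increment_sum :: "(real \<Rightarrow> real) \<Rightarrow> (real \<times> real) set \<Rightarrow> real" where
  "increment_sum g I = (\<Sum>(u, v)\<in>I. g v - g u)"

lemma interval_familiesD:
  assumes "I \<in> interval_families a b"
  shows "finite I" "\<And>u v. (u, v) \<in> I \<Longrightarrow> a \<le> u \<and> u < v \<and> v \<le> b"
    "disjoint_family_on (\<lambda>(u, v). {u<..<v}) I"
  using assms by (auto simp: interval_families_def)

lemma interval_families_disjoint:
  assumes "I \<in> interval_families a b" "(u, v) \<in> I" "(u', v') \<in> I" "(u, v) \<noteq> (u', v')"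
  shows "v \<le> u' \<or> v' \<le> u"
proof -
  have "{u<..<v} \<inter> {u'<..<v'} = {}"
    using disjoint_family_onD[OF interval_familiesD(3)[OF assms(1)] assms(2,3,4)] by simp
  moreover have "u < v" "u' < v'" using interval_familiesD(2)[OF assms(1)] assms(2,3) by auto
  ultimately show ?thesis
  proof -
    assume *: "{u<..<v} \<inter> {u'<..<v'} = {}" "u < v" "u' < v'"
    \<comment> \<open>If neither interval lay to the left of the other, the midpoint of the overlap
      would belong to both.\<close>
    have "(max u u' + min v v') / 2 \<notin> {u<..<v} \<inter> {u'<..<v'}" using * by blast
    then show ?thesis using * by (auto simp: max_def min_def field_simps split: if_splits)
  qed
qed

lemma interval_familiesI:
  assumes "finite I" "\<And>u v. (u, v) \<in> I \<Longrightarrow> a \<le> u \<and> u < v \<and> v \<le> b"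
    "\<And>u v u' v'. (u, v) \<in> I \<Longrightarrow> (u', v') \<in> I \<Longrightarrow> (u, v) \<noteq> (u', v') \<Longrightarrow> v \<le> u' \<or> v' \<le> u"
  shows "I \<in> interval_families a b"
proof -
  have "disjoint_family_on (\<lambda>(u, v). {u<..<v}) I"
    unfolding disjoint_family_on_def
  proof (intro ballI impI)
    fix p q assume pq: "p \<in> I" "q \<in> I" "p \<noteq> q"
    obtain u v u' v' where [simp]: "p = (u, v)" "q = (u', v')" by (cases p, cases q)
    show "(case p of (u, v) \<Rightarrow> {u<..<v}) \<inter> (case q of (u, v) \<Rightarrow> {u<..<v}) = {}"
      using assms(3)[of u v u' v'] pq by auto
  qed
  with assms show ?thesis by (auto simp: interval_families_def)
qed

lemma interval_families_subset:
  assumes "I \<in> interval_families a b" "J \<subseteq> I" "\<And>u v. (u, v) \<in> J \<Longrightarrow> c \<le> u \<and> v \<le> d"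
  shows "J \<in> interval_families c d"
proof (rule interval_familiesI)
  show "finite J" using assms(2) interval_familiesD(1)[OF assms(1)] by (rule finite_subset)
  show "c \<le> u \<and> u < v \<and> v \<le> d" if "(u, v) \<in> J" for u v
    using that assms(2,3) interval_familiesD(2)[OF assms(1)] by blast
  show "v \<le> u' \<or> v' \<le> u" if "(u, v) \<in> J" "(u', v') \<in> J" "(u, v) \<noteq> (u', v')" for u v u' v'
    using that assms(2) by (intro interval_families_disjoint[OF assms(1)]) auto
qed

lemma interval_families_mono:
  assumes "I \<in> interval_families a b" "c \<le> a" "b \<le> d"
  shows "I \<in> interval_families c d"
proof (rule interval_families_subset[OF assms(1) order_refl])
  fix u v assume "(u, v) \<in> I"
  from interval_familiesD(2)[OF assms(1) this] assms(2,3) show "c \<le> u \<and> v \<le> d" by linarith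
qed

lemma empty_interval_families: "{} \<in> interval_families a b"
  by (rule interval_familiesI) auto

lemma single_interval_families: "a < b \<Longrightarrow> {(a, b)} \<in> interval_families a b"
  by (rule interval_familiesI) auto

lemma increment_sum_empty [simp]: "increment_sum g {} = 0"
  by (simp add: increment_sum_def)

lemma increment_sum_single [simp]: "increment_sum g {(a, b)} = g b - g a"
  by (simp add: increment_sum_def)

lemma interval_families_Un:
  assumes "I \<in> interval_families a b" "J \<in> interval_families b c" "a \<le> b" "b \<le> c"
  shows "I \<union> J \<in> interval_families a c" "increment_sum g (I \<union> J) = increment_sum g I + increment_sum g J"
proof -
  note I = interval_familiesD(1,2)[OF assms(1)] interval_families_disjoint[OF assms(1)]
  note J = interval_familiesD(1,2)[OF assms(2)] interval_families_disjoint[OF assms(2)]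
  show "I \<union> J \<in> interval_families a c"
  proof (rule interval_familiesI)
    fix u v assume "(u, v) \<in> I \<union> J" then show "a \<le> u \<and> u < v \<and> v \<le> c"
      using I(2) J(2) assms(3,4) by force
  next
    fix u v u' v' assume *: "(u, v) \<in> I \<union> J" "(u', v') \<in> I \<union> J" "(u, v) \<noteq> (u', v')"
    from *(1,2) show "v \<le> u' \<or> v' \<le> u"
    proof (elim UnE)
      assume "(u, v) \<in> I" "(u', v') \<in> J"
      then show ?thesis using I(2)[of u v] J(2)[of u' v'] by linarith
    next
      assume "(u, v) \<in> J" "(u', v') \<in> I"
      then show ?thesis using J(2)[of u v] I(2)[of u' v'] by linarith
    qed (use I(3)[of u v u' v'] J(3)[of u v u' v'] *(3) in blast)+
  qed (use I J in auto)
  \<comment> \<open>A common member would lie in both [a, b] and [b, c], hence in a single point,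
    but members have positive length.\<close>
  have False if "(u, v) \<in> I" "(u, v) \<in> J" for u v
    using I(2)[OF that(1)] J(2)[OF that(2)] by linarith
  then have "I \<inter> J = {}" by auto
  then show "increment_sum g (I \<union> J) = increment_sum g I + increment_sum g J"
    unfolding increment_sum_def using I J by (intro sum.union_disjoint) auto
qed

text \<open>At most one member can straddle \<open>b\<close>. Cutting it there gives two intervals
  whose increments telescope; all other members already lie on one side. The same splitting serves
  every \<open>g\<close>.\<close>

lemma interval_families_split:
  assumes "I \<in> interval_families a c" "a \<le> b" "b \<le> c"
  obtains I1 I2 where "I1 \<in> interval_families a b" "I2 \<in> interval_families b c"
    "\<And>g. increment_sum g I = increment_sum g I1 + increment_sum g I2"
proof (cases "\<exists>u v. (u, v) \<in> I \<and> u < b \<and> b < v")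
  case False
  note I = interval_familiesD(1,2)[OF assms(1)] interval_families_disjoint[OF assms(1)]
  let ?I1 = "{p \<in> I. snd p \<le> b}" and ?I2 = "{p \<in> I. \<not> snd p \<le> b}"
  show thesis
  proof (rule that[of ?I1 ?I2])
    show "?I1 \<in> interval_families a b" using I False
      by (intro interval_families_subset[OF assms(1)]) auto
    show "?I2 \<in> interval_families b c"
    proof (rule interval_families_subset[OF assms(1)])
      fix u v assume "(u, v) \<in> ?I2"
      moreover from this False have "\<not> (u < b \<and> b < v)" by blast
      ultimately show "b \<le> u \<and> v \<le> c" using I(2)[of u v] by auto
    qed auto
    show "increment_sum g I = increment_sum g ?I1 + increment_sum g ?I2" for g
      unfolding increment_sum_def using I
      by (subst sum.union_disjoint[symmetric]) (auto intro!: sum.cong)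
  qed
next
  case True
  then obtain s t where st: "(s, t) \<in> I" "s < b" "b < t" by blast
  note I = interval_familiesD(1,2)[OF assms(1)] interval_families_disjoint[OF assms(1)]
  note Ist = I(3)[OF st(1)] 
  \<comment> \<open>Being disjoint from the straddling interval (s, t), every other member ends at
    or before s or begins at or after t.\<close>
  let ?J1 = "{p \<in> I. snd p \<le> s}" and ?J2 = "{p \<in> I. t \<le> fst p}"
  have J: "?J1 \<in> interval_families a s" "?J2 \<in> interval_families t c"
    by (rule interval_families_subset[OF assms(1)]; use I(2) in auto)+
  have s: "a \<le> s" "t \<le> c" using I(2) st by auto
  note U1 = interval_families_Un[OF J(1) single_interval_families[of s b]]
  note U2 = interval_families_Un[OF single_interval_families[of b t] J(2)]
  have disj: "?J1 \<inter> ?J2 = {}" "(s, t) \<notin> ?J1 \<union> ?J2"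
    using st by (auto dest: I(2))
  have un: "I = insert (s, t) (?J1 \<union> ?J2)"
  proof (intro equalityI subsetI)
    fix p assume "p \<in> I"
    then show "p \<in> insert (s, t) (?J1 \<union> ?J2)" using Ist[of "fst p" "snd p"] by (cases p) auto
  qed (use st in auto)
  have eq: "increment_sum g I = increment_sum g ?J1 + (g t - g s) + increment_sum g ?J2" for g
  proof -
    have "increment_sum g I = increment_sum g (insert (s, t) (?J1 \<union> ?J2))" using arg_cong[OF un, of "increment_sum g"] .
    also have "\<dots> = (g t - g s) + increment_sum g (?J1 \<union> ?J2)"
      unfolding increment_sum_def using disj I(1) by (subst sum.insert) auto
    also have "increment_sum g (?J1 \<union> ?J2) = increment_sum g ?J1 + increment_sum g ?J2"
      unfolding increment_sum_def using disj I(1) by (intro sum.union_disjoint) auto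
    finally show ?thesis by simp
  qed
  show thesis
  proof (rule that[OF U1(1) U2(1)])
    show "increment_sum g I = increment_sum g (?J1 \<union> {(s, b)}) + increment_sum g ({(b, t)} \<union> ?J2)" for g
      using U1(2)[of g] U2(2)[of g] s st eq[of g] by simp
  qed (use s st in auto)
qed

lemma interval_families_length_le:
  assumes "I \<in> interval_families a b" "(\<Union>(u, v)\<in>I. {u<..<v}) \<subseteq> A" "A \<in> sets lborel"
  shows "ennreal (\<Sum>(u, v)\<in>I. v - u) \<le> emeasure lborel A"
proof -
  note I = interval_familiesD[OF assms(1)]
  have "ennreal (\<Sum>(u, v)\<in>I. v - u) = (\<Sum>p\<in>I. ennreal (case p of (u, v) \<Rightarrow> v - u))"
    using I(2) by (subst sum_ennreal) force+
  also have "\<dots> = (\<Sum>p\<in>I. emeasure lborel (case p of (u, v) \<Rightarrow> {u<..<v}))"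
    using I(2) by (intro sum.cong) force+
  also have "\<dots> = emeasure lborel (\<Union>p\<in>I. case p of (u, v) \<Rightarrow> {u<..<v})"
    using I by (intro sum_emeasure) auto
  also have "\<dots> \<le> emeasure lborel A" using assms by (intro emeasure_mono) auto
  finally show ?thesis .
qed

lemma interval_families_length_le':
  assumes "I \<in> interval_families a b" "a \<le> b"
  shows "(\<Sum>(u, v)\<in>I. v - u) \<le> b - a"
proof -
  have "ennreal (\<Sum>(u, v)\<in>I. v - u) \<le> emeasure lborel {a..b}"
    using interval_familiesD(2)[OF assms(1)]
    by (intro interval_families_length_le[OF assms(1)]) force+
  then show ?thesis using assms(2) by (simp add: ennreal_le_iff)
qed

section \<open>Absolute continuity in terms of interval families, and boundedness of increment
  sums\<close>

lemma absolutely_continuous_fun_on_iff: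
  "absolutely_continuous_fun_on a b g \<longleftrightarrow>
    (\<forall>\<epsilon>>0. \<exists>\<delta>>0. \<forall>I\<in>interval_families a b. (\<Sum>(u, v)\<in>I. v - u) < \<delta> \<longrightarrow>
      (\<Sum>(u, v)\<in>I. \<bar>g v - g u\<bar>) < \<epsilon>)"
  unfolding absolutely_continuous_fun_on_def interval_families_def Ball_Collect[symmetric]
  by (simp only: Ball_def mem_Collect_eq imp_conjL)

lemma absolutely_continuous_fun_onD:
  assumes "absolutely_continuous_fun_on a b g" "\<epsilon> > 0"
  obtains \<delta> where "\<delta> > 0" "\<And>I. I \<in> interval_families a b \<Longrightarrow> (\<Sum>(u, v)\<in>I. v - u) < \<delta> \<Longrightarrow>
    (\<Sum>(u, v)\<in>I. \<bar>g v - g u\<bar>) < \<epsilon>"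
  using assms unfolding absolutely_continuous_fun_on_iff by metis

lemma absolutely_continuous_fun_onI:
  assumes "\<And>\<epsilon>. \<epsilon> > 0 \<Longrightarrow> \<exists>\<delta>>0. \<forall>I\<in>interval_families a b. (\<Sum>(u, v)\<in>I. v - u) < \<delta> \<longrightarrow>
    (\<Sum>(u, v)\<in>I. \<bar>g v - g u\<bar>) < \<epsilon>"
  shows "absolutely_continuous_fun_on a b g"
  unfolding absolutely_continuous_fun_on_iff using assms by simp

lemma absolutely_continuous_fun_on_diff:
  assumes "absolutely_continuous_fun_on a b f" "absolutely_continuous_fun_on a b g"
  shows "absolutely_continuous_fun_on a b (\<lambda>x. f x - g x)"
proof (rule absolutely_continuous_fun_onI)
  fix \<epsilon> :: real assume "\<epsilon> > 0"
  then have e: "\<epsilon> / 2 > 0" by simp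
  obtain d1 where d1: "d1 > 0" "\<And>I. I \<in> interval_families a b \<Longrightarrow> (\<Sum>(u, v)\<in>I. v - u) < d1 \<Longrightarrow>
    (\<Sum>(u, v)\<in>I. \<bar>f v - f u\<bar>) < \<epsilon> / 2" using absolutely_continuous_fun_onD[OF assms(1) e] by blast
  obtain d2 where d2: "d2 > 0" "\<And>I. I \<in> interval_families a b \<Longrightarrow> (\<Sum>(u, v)\<in>I. v - u) < d2 \<Longrightarrow>
    (\<Sum>(u, v)\<in>I. \<bar>g v - g u\<bar>) < \<epsilon> / 2" using absolutely_continuous_fun_onD[OF assms(2) e] by blast
  show "\<exists>\<delta>>0. \<forall>I\<in>interval_families a b. (\<Sum>(u, v)\<in>I. v - u) < \<delta> \<longrightarrow>
    (\<Sum>(u, v)\<in>I. \<bar>f v - g v - (f u - g u)\<bar>) < \<epsilon>"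
  proof (intro exI[of _ "min d1 d2"] conjI ballI impI)
    fix I assume I: "I \<in> interval_families a b" "(\<Sum>(u, v)\<in>I. v - u) < min d1 d2"
    have "(\<Sum>(u, v)\<in>I. \<bar>f v - g v - (f u - g u)\<bar>) \<le> (\<Sum>p\<in>I. (case p of (u, v) \<Rightarrow> \<bar>f v - f u\<bar>) + (case p of (u, v) \<Rightarrow> \<bar>g v - g u\<bar>))"
      by (intro sum_mono) auto
    also have "\<dots> = (\<Sum>(u, v)\<in>I. \<bar>f v - f u\<bar>) + (\<Sum>(u, v)\<in>I. \<bar>g v - g u\<bar>)"
      by (rule sum.distrib)
    also have "\<dots> < \<epsilon>" using d1(2)[OF I(1)] d2(2)[OF I(1)] I(2) by linarith
    finally show "(\<Sum>(u, v)\<in>I. \<bar>f v - g v - (f u - g u)\<bar>) < \<epsilon>" .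
  qed (use d1 d2 in auto)
qed

lemma increment_sum_le_abs: "increment_sum g I \<le> (\<Sum>(u, v)\<in>I. \<bar>g v - g u\<bar>)"
  unfolding increment_sum_def by (intro sum_mono) auto

text \<open>The \<open>d\<close> that belongs to \<epsilon> = 1 bounds the increment sum of any
  family on an interval shorter than \<open>d\<close> by 1. Cutting [0, 1] into \<open>Suc n\<close>
  such pieces bounds all increment sums by \<open>Suc n\<close>.\<close>

lemma absolutely_continuous_fun_on_bounded_increments:
  assumes "absolutely_continuous_fun_on 0 1 g"
  shows "bdd_above (increment_sum g ` interval_families 0 1)"
proof -
  obtain d where d: "d > 0" "\<And>I. I \<in> interval_families 0 1 \<Longrightarrow> (\<Sum>(u, v)\<in>I. v - u) < d \<Longrightarrow>
    (\<Sum>(u, v)\<in>I. \<bar>g v - g u\<bar>) < 1" using absolutely_continuous_fun_onD[OF assms, of 1] by auto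
  obtain n where n: "inverse (real (Suc n)) < d" using reals_Archimedean[OF d(1)] by blast
  let ?n = "real (Suc n)"
  have "k \<le> Suc n \<Longrightarrow> I \<in> interval_families 0 (real k / ?n) \<Longrightarrow> increment_sum g I \<le> real k" for k I
  proof (induction k arbitrary: I)
    case 0
    then have "I = {}" using interval_familiesD(2)[OF 0(2)] by force
    then show ?case by simp
  next
    case (Suc k)
    have k: "0 \<le> real k / ?n" "real k / ?n \<le> real (Suc k) / ?n" "real (Suc k) / ?n \<le> 1"
      using Suc.prems by (auto simp: field_simps)
    obtain I1 I2 where I12: "I1 \<in> interval_families 0 (real k / ?n)"
      "I2 \<in> interval_families (real k / ?n) (real (Suc k) / ?n)"
      "\<And>g. increment_sum g I = increment_sum g I1 + increment_sum g I2"
      using interval_families_split[OF Suc.prems(2) k(1,2)] by blast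
    have "(\<Sum>(u, v)\<in>I2. v - u) \<le> real (Suc k) / ?n - real k / ?n"
      by (rule interval_families_length_le'[OF I12(2) k(2)])
    also have "\<dots> = inverse ?n" by (simp add: field_simps)
    also have "\<dots> < d" by (rule n)
    finally have "(\<Sum>(u, v)\<in>I2. \<bar>g v - g u\<bar>) < 1"
      using d(2)[OF interval_families_mono[OF I12(2) k(1,3)]] by simp
    then have "increment_sum g I2 \<le> 1" using increment_sum_le_abs[of g I2] by linarith
    moreover have "increment_sum g I1 \<le> real k" using Suc I12(1) by simp
    ultimately show ?case using I12(3)[of g] by simp
  qed
  from this[of "Suc n"] show ?thesis by (intro bdd_aboveI[of _ ?n]) auto
qed

section \<open>Positive variation of an absolutely continuous function\<close>

definition positive_variation :: "(real \<Rightarrow> real) \<Rightarrow> real \<Rightarrow> real \<Rightarrow> real" where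
  "positive_variation g a b = (SUP I\<in>interval_families a b. increment_sum g I)"

lemma
  assumes "bdd_above (increment_sum g ` interval_families 0 1)" "0 \<le> a" "b \<le> 1"
  shows positive_variation_upper: "I \<in> interval_families a b \<Longrightarrow> increment_sum g I \<le> positive_variation g a b"
    and positive_variation_least: "(\<And>I. I \<in> interval_families a b \<Longrightarrow> increment_sum g I \<le> c) \<Longrightarrow> positive_variation g a b \<le> c"
proof -
  have "bdd_above (increment_sum g ` interval_families a b)"
    using assms interval_families_mono by (elim bdd_above_mono) blast
  then show "I \<in> interval_families a b \<Longrightarrow> increment_sum g I \<le> positive_variation g a b"
    unfolding positive_variation_def by (intro cSUP_upper) auto
  show "(\<And>I. I \<in> interval_families a b \<Longrightarrow> increment_sum g I \<le> c) \<Longrightarrow> positive_variation g a b \<le> c"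
    unfolding positive_variation_def using empty_interval_families by (intro cSUP_least) auto
qed

text \<open>The first two estimates make V = \<open>positive_variation g 0\<close> and V - g
  monotone, so g is a difference of monotone functions. The third comes from splitting families at x
  and carries absolute continuity over from g to V.\<close>

lemma positive_variation_increment:
  assumes B: "bdd_above (increment_sum g ` interval_families 0 1)"
    and "0 \<le> x" "x \<le> y" "y \<le> 1"
  shows "positive_variation g 0 x \<le> positive_variation g 0 y"
    "positive_variation g 0 x + (g y - g x) \<le> positive_variation g 0 y"
    "positive_variation g 0 y \<le> positive_variation g 0 x + positive_variation g x y"
proof -
  note upper = positive_variation_upper[OF B] and least = positive_variation_least[OF B]
  show "positive_variation g 0 x \<le> positive_variation g 0 y"
    using assms interval_families_mono by (intro least upper) auto
  have "positive_variation g 0 x \<le> positive_variation g 0 y - (g y - g x)"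
  proof (rule least)
    fix I assume I: "I \<in> interval_families 0 x"
    show "increment_sum g I \<le> positive_variation g 0 y - (g y - g x)"
    proof (cases "x = y")
      case True
      with I show ?thesis using assms upper by auto
    next
      case False
      with assms have "x < y" by simp
      note U = interval_families_Un[OF I single_interval_families[OF this] _ assms(3)]
      show ?thesis using upper[OF _ _ U(1)] U(2)[of g] assms by simp
    qed
  qed (use assms in auto)
  then show "positive_variation g 0 x + (g y - g x) \<le> positive_variation g 0 y" by simp
  show "positive_variation g 0 y \<le> positive_variation g 0 x + positive_variation g x y"
  proof (rule least)
    fix I assume I: "I \<in> interval_families 0 y"
    obtain I1 I2 where I12: "I1 \<in> interval_families 0 x" "I2 \<in> interval_families x y"
      "\<And>g. increment_sum g I = increment_sum g I1 + increment_sum g I2"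
      using interval_families_split[OF I assms(2,3)] by blast
    show "increment_sum g I \<le> positive_variation g 0 x + positive_variation g x y"
      using I12(3)[of g] upper[OF _ _ I12(1)] upper[OF _ _ I12(2)] assms by simp
  qed (use assms in auto)
qed

text \<open>Inside each member of I a nearly optimal family is chosen. The union K of these families
  has total length at most that of I, so the \<open>d\<close> that serves g for \<epsilon> / 2
  controls the increments of the variation as well.\<close>

lemma positive_variation_absolutely_continuous:
  assumes g: "absolutely_continuous_fun_on 0 1 g"
  shows "absolutely_continuous_fun_on 0 1 (positive_variation g 0)"
proof (rule absolutely_continuous_fun_onI)
  note B = absolutely_continuous_fun_on_bounded_increments[OF g]
  let ?V = "positive_variation g"
  fix \<epsilon> :: real assume "\<epsilon> > 0"
  then have e: "\<epsilon> / 2 > 0" by simp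
  obtain d where d: "d > 0" "\<And>I. I \<in> interval_families 0 1 \<Longrightarrow> (\<Sum>(u, v)\<in>I. v - u) < d \<Longrightarrow>
    (\<Sum>(u, v)\<in>I. \<bar>g v - g u\<bar>) < \<epsilon> / 2" using absolutely_continuous_fun_onD[OF g e] by blast
  show "\<exists>\<delta>>0. \<forall>I\<in>interval_families 0 1. (\<Sum>(u, v)\<in>I. v - u) < \<delta> \<longrightarrow>
    (\<Sum>(u, v)\<in>I. \<bar>?V 0 v - ?V 0 u\<bar>) < \<epsilon>"
  proof (intro exI[of _ d] conjI ballI impI)
    fix I assume I: "I \<in> interval_families 0 1" and Id: "(\<Sum>(u, v)\<in>I. v - u) < d"
    note I' = interval_familiesD(1,2)[OF I] interval_families_disjoint[OF I]
    \<comment> \<open>The \<open>card I\<close> errors of size \<eta> add up to less than \<epsilon>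
      / 2; the summand 1 keeps the denominator positive for empty I.\<close>
    define \<eta> where "\<eta> = \<epsilon> / 2 / (real (card I) + 1)"
    have \<eta>: "\<eta> > 0" "real (card I) * \<eta> < \<epsilon> / 2" using e by (auto simp: \<eta>_def field_simps)
    have "\<forall>p\<in>I. \<exists>J. J \<in> interval_families (fst p) (snd p) \<and> ?V (fst p) (snd p) - \<eta> \<le> increment_sum g J"
    proof
      fix p assume "p \<in> I"
      then have p: "0 \<le> fst p" "snd p \<le> 1" using I'(2)[of "fst p" "snd p"] by auto
      show "\<exists>J. J \<in> interval_families (fst p) (snd p) \<and> ?V (fst p) (snd p) - \<eta> \<le> increment_sum g J"
      proof (rule ccontr)
        \<comment> \<open>Otherwise the supremum minus \<eta> would still bound all increment
          sums.\<close>
        assume "\<not> ?thesis"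
        then have "?V (fst p) (snd p) \<le> ?V (fst p) (snd p) - \<eta>"
          by (intro positive_variation_least[OF B p]) (auto simp: not_le intro: less_imp_le)
        with \<eta> show False by simp
      qed
    qed
    from bchoice[OF this] obtain J where J: "\<And>p. p \<in> I \<Longrightarrow> J p \<in> interval_families (fst p) (snd p)"
      "\<And>p. p \<in> I \<Longrightarrow> ?V (fst p) (snd p) - \<eta> \<le> increment_sum g (J p)" by blast
    define K where "K = (\<Union>p\<in>I. J p)"
    have Jp: "fst p \<le> u \<and> u < v \<and> v \<le> snd p" if "p \<in> I" "(u, v) \<in> J p" for p u v
      using interval_familiesD(2)[OF J(1)[OF that(1)] that(2)] .
    have K: "K \<in> interval_families 0 1"
    proof (rule interval_familiesI)
      show "finite K" unfolding K_def using I'(1) J(1) interval_familiesD(1) by blast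
      fix u v assume "(u, v) \<in> K"
      then obtain p where p: "p \<in> I" "(u, v) \<in> J p" by (auto simp: K_def)
      then show "0 \<le> u \<and> u < v \<and> v \<le> 1" using Jp[OF p] I'(2)[of "fst p" "snd p"] by simp
    next
      fix u v u' v' assume *: "(u, v) \<in> K" "(u', v') \<in> K" "(u, v) \<noteq> (u', v')"
      then obtain p q where p: "p \<in> I" "(u, v) \<in> J p" and q: "q \<in> I" "(u', v') \<in> J q" by (auto simp: K_def)
      show "v \<le> u' \<or> v' \<le> u"
      proof (cases "p = q")
        case True
        then show ?thesis using interval_families_disjoint[OF J(1)[OF p(1)]] p q * by blast
      next
        case False
        then show ?thesis using Jp[OF p] Jp[OF q] I'(3)[of "fst p" "snd p" "fst q" "snd q"] p q
          by (cases p, cases q) force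
      qed
    qed
    have disj: "J p \<inter> J q = {}" if pq: "p \<in> I" "q \<in> I" "p \<noteq> q" for p q
    proof -
      have False if "(u, v) \<in> J p" "(u, v) \<in> J q" for u v
        using Jp[OF pq(1) that(1)] Jp[OF pq(2) that(2)] I'(3)[of "fst p" "snd p" "fst q" "snd q"] pq
        by (cases p, cases q) force
      then show ?thesis by auto
    qed
    have sumK: "(\<Sum>q\<in>K. f q) = (\<Sum>p\<in>I. \<Sum>q\<in>J p. f q)" for f :: "real \<times> real \<Rightarrow> real"
      unfolding K_def using I'(1) J(1) interval_familiesD(1) disj by (intro sum.UNION_disjoint) blast+
    have "(\<Sum>(u, v)\<in>K. v - u) \<le> (\<Sum>p\<in>I. snd p - fst p)"
      unfolding sumK
    proof (intro sum_mono)
      fix p assume "p \<in> I"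
      then show "(\<Sum>(u, v)\<in>J p. v - u) \<le> snd p - fst p"
        using interval_families_length_le'[OF J(1)] I'(2)[of "fst p" "snd p"] by simp
    qed
    also have "\<dots> < d" using Id by (simp add: case_prod_unfold)
    finally have "increment_sum g K < \<epsilon> / 2"
      using d(2)[OF K] increment_sum_le_abs[of g K] by linarith
    have "(\<Sum>(u, v)\<in>I. \<bar>?V 0 v - ?V 0 u\<bar>) \<le> (\<Sum>p\<in>I. increment_sum g (J p) + \<eta>)"
    proof (intro sum_mono)
      fix p assume p: "p \<in> I"
      obtain u v where [simp]: "p = (u, v)" by (cases p)
      have "0 \<le> u" "u \<le> v" "v \<le> 1" using I'(2)[of u v] p by auto
      from positive_variation_increment(1,3)[OF B this] J(2)[OF p]
      show "(case p of (u, v) \<Rightarrow> \<bar>?V 0 v - ?V 0 u\<bar>) \<le> increment_sum g (J p) + \<eta>"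
        by simp
    qed
    also have "\<dots> = increment_sum g K + real (card I) * \<eta>"
      by (simp add: sum.distrib increment_sum_def sumK)
    also have "\<dots> < \<epsilon>" using \<open>increment_sum g K < \<epsilon> / 2\<close> \<eta> by linarith
    finally show "(\<Sum>(u, v)\<in>I. \<bar>?V 0 v - ?V 0 u\<bar>) < \<epsilon>" .
  qed (use d in auto)
qed

section \<open>The Stieltjes measure of a monotone absolutely continuous function and its
  density\<close>

lemma absolutely_continuous_fun_on_continuous:
  assumes "absolutely_continuous_fun_on a b g"
  shows "continuous_on {a..b} g"
  unfolding continuous_on_iff
proof (intro ballI allI impI)
  fix x and e :: real assume x: "x \<in> {a..b}" and e: "0 < e"
  obtain d where d: "d > 0" "\<And>I. I \<in> interval_families a b \<Longrightarrow> (\<Sum>(u, v)\<in>I. v - u) < d \<Longrightarrow>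
    (\<Sum>(u, v)\<in>I. \<bar>g v - g u\<bar>) < e" using absolutely_continuous_fun_onD[OF assms e] by blast
  have less: "\<bar>g v - g u\<bar> < e" if "a \<le> u" "u < v" "v \<le> b" "v - u < d" for u v
    using d(2)[OF interval_families_mono[OF single_interval_families[of u v]]] that by simp
  show "\<exists>d>0. \<forall>x'\<in>{a..b}. dist x' x < d \<longrightarrow> dist (g x') (g x) < e"
  proof (intro exI[of _ d] conjI ballI impI)
    fix y assume y: "y \<in> {a..b}" "dist y x < d"
    consider "y = x" | "y < x" | "x < y" by linarith
    then show "dist (g y) (g x) < e"
      by cases (use less[of x y] less[of y x] x y e in \<open>auto simp: dist_real_def abs_minus_commute\<close>)
  qed (use d in auto)
qed

text \<open>The formula \<open>emeasure_interval_measure_Icc\<close> asks for a monotone continuous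
  function on the whole line; clamping the argument extends F beyond [0, 1] by its end
  values.\<close>

lemma clamp_mono_continuous:
  fixes F :: "real \<Rightarrow> real"
  assumes "mono_on {0..1} F" "continuous_on {0..1} F"
  defines "G \<equiv> \<lambda>x. F (max 0 (min 1 x))"
  shows "x \<le> y \<Longrightarrow> G x \<le> G y" "continuous_on UNIV G"
proof -
  show "x \<le> y \<Longrightarrow> G x \<le> G y" unfolding G_def using assms(1) by (auto simp: mono_on_def)
  show "continuous_on UNIV G" unfolding G_def
    by (rule continuous_on_compose2[OF assms(2)]) (auto intro!: continuous_intros)
qed

text \<open>Outer regularity puts N into an open set T of Lebesgue measure below d. Countably many
  non-overlapping closed intervals inside T cover N. Absolute continuity bounds the Stieltjes
  measure of any finitely many of them by e, and continuity from below passes to all of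
  them.\<close>

lemma interval_measure_null_set:
  fixes F :: "real \<Rightarrow> real"
  assumes F: "absolutely_continuous_fun_on 0 1 F" "mono_on {0..1} F"
    and N: "N \<in> null_sets lborel" "N \<subseteq> {0..1}"
  shows "emeasure (interval_measure (\<lambda>x. F (max 0 (min 1 x)))) N = 0"
proof -
  define G where "G x = F (max 0 (min 1 x))" for x
  have G: "\<And>x y. x \<le> y \<Longrightarrow> G x \<le> G y" "continuous_on UNIV G"
    using clamp_mono_continuous[OF F(2) absolutely_continuous_fun_on_continuous[OF F(1)]]
    unfolding G_def by auto
  define M where "M = interval_measure G"
  have M[simp]: "sets M = sets borel" by (simp add: M_def)
  have Icc: "emeasure M {u..v} = ennreal (G v - G u)" if "u \<le> v" for u v
    unfolding M_def using emeasure_interval_measure_Icc[OF that G] .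
  have le: "emeasure M N \<le> ennreal e" if e: "e > 0" for e
  proof -
    obtain d where d: "d > 0" "\<And>I. I \<in> interval_families 0 1 \<Longrightarrow> (\<Sum>(u, v)\<in>I. v - u) < d \<Longrightarrow>
      (\<Sum>(u, v)\<in>I. \<bar>F v - F u\<bar>) < e" using absolutely_continuous_fun_onD[OF F(1) e] by blast
    have "N \<in> sets lebesgue" using N by auto
    then obtain T where T: "open T" "N \<subseteq> T"
      "T - N \<in> lmeasurable" "emeasure lebesgue (T - N) < ennreal d"
      by (rule sets_lebesgue_outer_open[OF _ d(1)])
    have "emeasure lborel T = emeasure lborel (T - N)"
      using N(1) T(1) by (subst emeasure_Diff_null_set) auto
    also have "\<dots> = emeasure lebesgue (T - N)" using N(1) T(1) by (subst emeasure_completion) auto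
    finally have Td: "emeasure lborel T < ennreal d" using T(4) by simp
    \<comment> \<open>The covering lemma picks its tags in N, which lies in T, so this gauge forces
      every covering interval into T.\<close>
    define \<gamma> where "\<gamma> x = (if x \<in> T then T else UNIV)" for x
    have "gauge \<gamma>" unfolding gauge_def \<gamma>_def using T(1) by auto
    obtain D where D: "countable D" "\<Union>D \<subseteq> cbox 0 1"
      "\<And>K. K \<in> D \<Longrightarrow> interior K \<noteq> {} \<and> (\<exists>c d. K = cbox c d)"
      "pairwise (\<lambda>A B. interior A \<inter> interior B = {}) D"
      "\<And>K. K \<in> D \<Longrightarrow> \<exists>x \<in> N \<inter> K. K \<subseteq> \<gamma> x" "N \<subseteq> \<Union>D"
      by (rule covering_lemma[of N 0 1 \<gamma>]) (use N \<open>gauge \<gamma>\<close> in auto)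
    have DT: "K \<subseteq> T" if "K \<in> D" for K
    proof -
      from D(5)[OF that] obtain x where "x \<in> N" "K \<subseteq> \<gamma> x" by blast
      with T(2) show ?thesis by (auto simp: \<gamma>_def subset_iff)
    qed
    \<comment> \<open>Each box is a nondegenerate closed interval, so its endpoints can be recovered
      from the set itself.\<close>
    define l r :: "real set \<Rightarrow> real" where "l K = Inf K" and "r K = Sup K" for K
    have lr: "l K < r K \<and> K = {l K..r K} \<and> interior K = {l K<..<r K} \<and> 0 \<le> l K \<and> r K \<le> 1" if K: "K \<in> D" for K
    proof -
      from D(3)[OF K] obtain c d where cd: "K = cbox c d" "interior K \<noteq> {}" by blast
      then have less: "c < d" by simp
      with cd have lrK: "l K = c" "r K = d" by (auto simp: l_def r_def)
      have "c \<in> K" "d \<in> K" using cd(1) less by auto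
      then have "c \<in> cbox 0 1" "d \<in> cbox 0 1" using D(2) K by blast+
      then have "c \<in> {0..1}" "d \<in> {0..1}" by simp_all
      moreover have "interior K = {c<..<d}" using cd(1) by (simp add: interior_atLeastAtMost_real)
      ultimately show ?thesis unfolding lrK using cd(1) less by simp
    qed
    have fin: "emeasure M (\<Union>E) \<le> ennreal e" if E: "finite E" "E \<subseteq> D" for E
    proof -
      define I where "I = (\<lambda>K. (l K, r K)) ` E"
      have inj: "inj_on (\<lambda>K. (l K, r K)) E" 
      proof (rule inj_onI)
        fix K L assume KL: "K \<in> E" "L \<in> E" "(l K, r K) = (l L, r L)"
        then have "K = {l K..r K}" "L = {l L..r L}" using lr E by blast+
        with KL(3) show "K = L" by (metis Pair_inject)
      qed
      have sumI: "(\<Sum>(u, v)\<in>I. f u v) = (\<Sum>K\<in>E. f (l K) (r K))" for f :: "real \<Rightarrow> real \<Rightarrow> real"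
        unfolding I_def by (subst sum.reindex[OF inj]) simp
      have I: "I \<in> interval_families 0 1"
        unfolding interval_families_def mem_Collect_eq
      proof (intro conjI)
        show "finite I" unfolding I_def using E by simp
        show "\<forall>(u, v)\<in>I. 0 \<le> u \<and> u < v \<and> v \<le> 1"
        proof clarify
          fix u v assume "(u, v) \<in> I"
          then obtain K where K: "K \<in> D" "u = l K" "v = r K" using E(2) by (auto simp: I_def)
          then show "0 \<le> u \<and> u < v \<and> v \<le> 1" using lr[OF K(1)] by simp
        qed
        show "disjoint_family_on (\<lambda>(u, v). {u<..<v}) I"
          unfolding disjoint_family_on_def
        proof (intro ballI impI)
          fix p q assume "p \<in> I" "q \<in> I" "p \<noteq> q"
          then obtain K L where KL: "K \<in> E" "L \<in> E" "p = (l K, r K)" "q = (l L, r L)" by (auto simp: I_def)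
          with \<open>p \<noteq> q\<close> have "K \<noteq> L" by auto
          then have "interior K \<inter> interior L = {}" using D(4) KL E(2) unfolding pairwise_def by blast
          moreover have "interior K = {l K<..<r K}" "interior L = {l L<..<r L}"
            using lr[of K] lr[of L] KL(1,2) E(2) by blast+
          ultimately show "(case p of (u, v) \<Rightarrow> {u<..<v}) \<inter> (case q of (u, v) \<Rightarrow> {u<..<v}) = {}"
            using KL by simp
        qed
      qed
      have "ennreal (\<Sum>(u, v)\<in>I. v - u) \<le> emeasure lborel T"
      proof (rule interval_families_length_le[OF I])
        have "{l K<..<r K} \<subseteq> T" if "K \<in> E" for K
        proof -
          have K: "K \<in> D" using that E(2) by blast
          show ?thesis using lr[OF K] DT[OF K] interior_subset[of K] by blast
        qed
        then show "(\<Union>(u, v)\<in>I. {u<..<v}) \<subseteq> T" unfolding I_def by auto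
      qed (use T(1) in auto)
      also note Td
      finally have "(\<Sum>(u, v)\<in>I. v - u) < d" by (metis ennreal_leI not_le)
      from d(2)[OF I this] have less_e: "(\<Sum>K\<in>E. \<bar>F (r K) - F (l K)\<bar>) < e" by (simp add: sumI)
      have "emeasure M (\<Union>E) \<le> (\<Sum>K\<in>E. emeasure M K)"
      proof -
        have "emeasure M (\<Union>K\<in>E. K) \<le> (\<Sum>K\<in>E. emeasure M K)"
        proof (rule emeasure_subadditive_finite)
          show "(\<lambda>K. K) ` E \<subseteq> sets M"
          proof clarify
            fix K assume "K \<in> E"
            then have "K = {l K..r K}" using lr E(2) by blast
            then show "K \<in> sets M" by (metis M atLeastAtMost_borel)
          qed
        qed (rule E)
        then show ?thesis by simp
      qed
      also have "\<dots> \<le> (\<Sum>K\<in>E. ennreal \<bar>F (r K) - F (l K)\<bar>)"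
      proof (intro sum_mono)
        fix K assume "K \<in> E"
        with E have K: "l K < r K" "K = {l K..r K}" "0 \<le> l K" "r K \<le> 1" using lr by auto
        have "emeasure M K = ennreal (G (r K) - G (l K))"
          using Icc[of "l K" "r K"] K(1) by (subst K(2)) simp
        also have "\<dots> = ennreal (F (r K) - F (l K))" using K by (simp add: G_def)
        finally show "emeasure M K \<le> ennreal \<bar>F (r K) - F (l K)\<bar>" by (simp add: ennreal_leI)
      qed
      also have "\<dots> = ennreal (\<Sum>K\<in>E. \<bar>F (r K) - F (l K)\<bar>)" by simp
      also have "\<dots> \<le> ennreal e" using less_e by (intro ennreal_leI) simp
      finally show ?thesis .
    qed
    \<comment> \<open>Enumerating D by \<open>from_nat_into\<close> presupposes that D is nonempty;
      if D is empty, so is N.\<close>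
    show ?thesis
    proof (cases "D = {}")
      case True
      then show ?thesis using D(6) by simp
    next
      case False
      let ?A = "\<lambda>n. \<Union>(from_nat_into D ` {..n})"
      have "N \<subseteq> (\<Union>n. ?A n)"
      proof
        fix x assume "x \<in> N"
        then obtain K where K: "K \<in> D" "x \<in> K" using D(6) by blast
        then obtain n where "K = from_nat_into D n"
          using range_from_nat_into[OF False D(1)] by (metis rangeE)
        with K show "x \<in> (\<Union>n. ?A n)" by auto
      qed
      moreover have *: "?A n \<in> sets M" for n
      proof (intro sets.finite_Union)
        show "from_nat_into D ` {..n} \<subseteq> sets M"
        proof
          fix K assume "K \<in> from_nat_into D ` {..n}"
          then have "K \<in> D" using from_nat_into[OF False] by auto
          then have "K = {l K..r K}" using lr by blast
          then show "K \<in> sets M" by (metis M atLeastAtMost_borel)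
        qed
      qed simp
      ultimately have "emeasure M N \<le> emeasure M (\<Union>n. ?A n)" by (intro emeasure_mono) auto
      also have "\<dots> = (SUP n. emeasure M (?A n))"
        using * by (intro SUP_emeasure_incseq[symmetric]) (auto simp: incseq_def intro: order_trans)
      also have "\<dots> \<le> ennreal e" using from_nat_into[OF False] by (intro SUP_least fin) auto
      finally show ?thesis .
    qed
  qed
  have "emeasure M N \<le> 0"
  proof (rule ennreal_le_epsilon)
    fix e :: real assume "0 < e"
    from le[OF this] show "emeasure M N \<le> 0 + ennreal e" by simp
  qed
  then show ?thesis unfolding M_def G_def by simp
qed

lemma mono_absolutely_continuous_density:
  fixes F :: "real \<Rightarrow> real"
  assumes F: "absolutely_continuous_fun_on 0 1 F" "mono_on {0..1} F"
  obtains \<phi> where "set_integrable lborel {0..1} \<phi>"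
    "\<And>x. x \<in> {0..1} \<Longrightarrow> F x = F 0 + (LINT t:{0..x}|lborel. \<phi> t)"
proof -
  define G where "G x = F (max 0 (min 1 x))" for x
  have G: "\<And>x y. x \<le> y \<Longrightarrow> G x \<le> G y" "continuous_on UNIV G"
    using clamp_mono_continuous[OF F(2) absolutely_continuous_fun_on_continuous[OF F(1)]]
    unfolding G_def by auto
  define M where "M = interval_measure G"
  have [measurable_cong, simp]: "sets M = sets borel" by (simp add: M_def)
  have Icc: "emeasure M {0..x} = ennreal (F x - F 0)" if "x \<in> {0..1}" for x
    using that emeasure_interval_measure_Icc[of 0 x, OF _ G] unfolding M_def by (simp add: G_def)
  \<comment> \<open>The restriction to [0, 1] matches \<open>interval_measure_null_set\<close>,
    which speaks of subsets of [0, 1].\<close>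
  define M' where "M' = density M (indicator {0..1})"
  have M': "emeasure M' A = emeasure M (A \<inter> {0..1})" if "A \<in> sets borel" for A
    unfolding M'_def using that by (subst emeasure_density) (auto simp: indicator_inter_arith[symmetric] Int_commute)
  have "absolutely_continuous lborel M'"
    unfolding absolutely_continuous_def
  proof
    fix N :: "real set" assume N: "N \<in> null_sets lborel"
    then have "N \<inter> {0..1} \<in> null_sets lborel" by (intro null_set_Int2) auto
    then have "emeasure M (N \<inter> {0..1}) = 0"
      using interval_measure_null_set[OF F, of "N \<inter> {0..1}"] unfolding M_def G_def by auto
    with N M'[of N] show "N \<in> null_sets M'" by (intro null_setsI) (auto simp: M'_def)
  qed
  then obtain f where f[measurable]: "f \<in> borel_measurable lborel" and dens: "density lborel f = M'"
    using sigma_finite_measure.Radon_Nikodym[OF sigma_finite_lborel, of M'] by (auto simp: M'_def)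
  have int: "(\<integral>\<^sup>+t. f t * indicator {0..x} t \<partial>lborel) = ennreal (F x - F 0)" if x: "x \<in> {0..1}" for x
  proof -
    have "(\<integral>\<^sup>+t. f t * indicator {0..x} t \<partial>lborel) = emeasure M' {0..x}"
      unfolding dens[symmetric] by (subst emeasure_density) auto
    also have "\<dots> = emeasure M {0..x}" using x by (subst M') (auto simp: Int_absorb2)
    finally show ?thesis using Icc[OF x] by simp
  qed
  define \<phi> where "\<phi> t = enn2real (f t)" for t
  have [measurable]: "\<phi> \<in> borel_measurable lborel" unfolding \<phi>_def by measurable
  \<comment> \<open>The Radon-Nikodym density is extended real valued. Its integral over [0, 1] is F
    1 - F 0, so it is finite almost everywhere there and passing to real values loses
    nothing.\<close>
  have "AE t in lborel. f t * indicator {0..1} t \<noteq> \<infinity>"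
    using int[of 1] by (intro nn_integral_PInf_AE) auto
  then have ae: "AE t in lborel. t \<in> {0..1} \<longrightarrow> ennreal (\<phi> t) = f t"
    by eventually_elim (auto simp: \<phi>_def indicator_def less_top)
  have int': "(\<integral>\<^sup>+t. ennreal (indicator {0..x} t * \<phi> t) \<partial>lborel) = ennreal (F x - F 0)" if x: "x \<in> {0..1}" for x
  proof -
    have "(\<integral>\<^sup>+t. ennreal (indicator {0..x} t * \<phi> t) \<partial>lborel) = (\<integral>\<^sup>+t. f t * indicator {0..x} t \<partial>lborel)"
      using ae x by (intro nn_integral_cong_AE) (auto elim!: eventually_mono simp: indicator_def)
    with int[OF x] show ?thesis by simp
  qed
  have le: "0 \<le> F x - F 0" if "x \<in> {0..1}" for x using F(2) that by (auto simp: mono_on_def)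
  show thesis
  proof
    show "set_integrable lborel {0..1} \<phi>"
      unfolding set_integrable_def using int'[of 1]
      by (intro integrableI_nonneg) (auto simp: \<phi>_def)
    fix x :: real assume x: "x \<in> {0..1}"
    have "(LINT t:{0..x}|lborel. \<phi> t) = F x - F 0"
      unfolding set_lebesgue_integral_def
      using int'[OF x] le[OF x] by (subst integral_eq_nn_integral) (auto simp: \<phi>_def)
    then show "F x = F 0 + (LINT t:{0..x}|lborel. \<phi> t)" by simp
  qed
qed

text \<open>The positive variation V and V - g are both monotone and absolutely continuous, so each
  has a density; their difference is a density for g.\<close>

lemma absolutely_continuous_fun_density:
  assumes g: "absolutely_continuous_fun_on 0 1 g"
  obtains \<phi> where "set_integrable lborel {0..1} \<phi>"
    "\<And>x. x \<in> {0..1} \<Longrightarrow> g x = g 0 + (LINT t:{0..x}|lborel. \<phi> t)"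
proof -
  let ?V = "positive_variation g 0"
  note B = absolutely_continuous_fun_on_bounded_increments[OF g]
  note V = positive_variation_absolutely_continuous[OF g]
  have "mono_on {0..1} ?V" by (intro mono_onI positive_variation_increment(1)[OF B]) auto
  then obtain \<phi> where \<phi>: "set_integrable lborel {0..1} \<phi>"
    "\<And>x. x \<in> {0..1} \<Longrightarrow> ?V x = ?V 0 + (LINT t:{0..x}|lborel. \<phi> t)"
    using mono_absolutely_continuous_density[OF V] by blast
  have "mono_on {0..1} (\<lambda>x. ?V x - g x)"
    using positive_variation_increment(2)[OF B] by (intro mono_onI) (fastforce simp: algebra_simps)
  then obtain \<psi> where \<psi>: "set_integrable lborel {0..1} \<psi>"
    "\<And>x. x \<in> {0..1} \<Longrightarrow> ?V x - g x = ?V 0 - g 0 + (LINT t:{0..x}|lborel. \<psi> t)"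
    using mono_absolutely_continuous_density[OF absolutely_continuous_fun_on_diff[OF V g]] by blast
  show thesis
  proof
    show "set_integrable lborel {0..1} (\<lambda>t. \<phi> t - \<psi> t)" using \<phi>(1) \<psi>(1) by (rule set_integral_diff)
    fix x :: real assume x: "x \<in> {0..1}"
    then have "set_integrable lborel {0..x} \<phi>" "set_integrable lborel {0..x} \<psi>"
      using \<phi>(1) \<psi>(1) by (auto intro: set_integrable_subset)
    then have "(LINT t:{0..x}|lborel. \<phi> t - \<psi> t) = (LINT t:{0..x}|lborel. \<phi> t) - (LINT t:{0..x}|lborel. \<psi> t)"
      by (rule set_integral_diff)
    then show "g x = g 0 + (LINT t:{0..x}|lborel. \<phi> t - \<psi> t)" using \<phi>(2)[OF x] \<psi>(2)[OF x] by simp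
  qed
qed

section \<open>Fractional integration\<close>

text \<open>Extending the kernel by zero to t \<le> 0 turns the integral over [0, x] into a
  convolution on the whole line.\<close>

definition fractional_kernel :: "real \<Rightarrow> real \<Rightarrow> real" where
  "fractional_kernel a t = (if 0 < t then t powr (a - 1) / Gamma a else 0)"

lemma fractional_kernel_measurable [measurable]: "fractional_kernel a \<in> borel_measurable borel"
  unfolding fractional_kernel_def[abs_def] by measurable

lemma fractional_kernel_nonneg: "0 < a \<Longrightarrow> 0 \<le> fractional_kernel a t"
  by (auto simp: fractional_kernel_def intro!: divide_nonneg_nonneg)

text \<open>The substitution t = s + c u with c = x - s leads to a Beta integral, and Beta b a =
  Gamma a Gamma b / Gamma (a + b). The form with a nonnegative integral yields integrability
  together with the value.\<close>

lemma fractional_kernel_convolution: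
  assumes a: "0 < a" and b: "0 < b"
  shows "(\<integral>\<^sup>+t. ennreal (fractional_kernel a (x - t) * fractional_kernel b (t - s)) \<partial>lborel)
    = ennreal (fractional_kernel (a + b) (x - s))"
proof (cases "s < x")
  case False
  then have 1: "fractional_kernel a (x - t) * fractional_kernel b (t - s) = 0" for t
    by (auto simp: fractional_kernel_def)
  have 2: "fractional_kernel (a + b) (x - s) = 0" using False by (simp add: fractional_kernel_def)
  show ?thesis unfolding 1 2 by simp
next
  case True
  define c where "c = x - s"
  have c: "c > 0" using True by (simp add: c_def)
  have G: "Gamma a > 0" "Gamma b > 0" "Gamma (a + b) > 0" using a b by (auto intro: Gamma_real_pos)
  have eq: "fractional_kernel a (x - (s + c * u)) * fractional_kernel b ((s + c * u) - s)
      = c powr (a + b - 2) / (Gamma a * Gamma b) * (indicator {0..1} u * (u powr (b - 1) * (1 - u) powr (a - 1)))" for u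
  proof -
    have 1: "x - (s + c * u) = c * (1 - u)" "(s + c * u) - s = c * u" by (simp_all add: c_def algebra_simps)
    have 2: "c powr (a - 1) * c powr (b - 1) = c powr (a + b - 2)"
      by (simp flip: powr_add)
    show ?thesis
    proof (cases "0 < u \<and> u < 1")
      case True
      then have "fractional_kernel a (c * (1 - u)) * fractional_kernel b (c * u)
        = (c powr (a - 1) * c powr (b - 1)) / (Gamma a * Gamma b) * (u powr (b - 1) * (1 - u) powr (a - 1))"
        using c by (simp add: fractional_kernel_def powr_mult)
      with True show ?thesis unfolding 1 2 by simp
    next
      case False
      then show ?thesis unfolding 1 using c
        by (auto simp: fractional_kernel_def zero_less_mult_iff indicator_def)
    qed
  qed
  have "(\<integral>\<^sup>+t. ennreal (fractional_kernel a (x - t) * fractional_kernel b (t - s)) \<partial>lborel)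
    = ennreal \<bar>c\<bar> * (\<integral>\<^sup>+u. ennreal (fractional_kernel a (x - (s + c * u)) * fractional_kernel b ((s + c * u) - s)) \<partial>lborel)"
    using c by (intro nn_integral_real_affine) auto
  also have "\<dots> = ennreal c * (\<integral>\<^sup>+u. ennreal (c powr (a + b - 2) / (Gamma a * Gamma b)) *
      ennreal (indicator {0..1} u * (u powr (b - 1) * (1 - u) powr (a - 1))) \<partial>lborel)"
  proof -
    have "\<bar>c\<bar> = c" "0 \<le> c powr (a + b - 2) / (Gamma a * Gamma b)" using c G by simp_all
    then show ?thesis unfolding eq by (simp only: ennreal_mult')
  qed
  also have "\<dots> = ennreal c * (ennreal (c powr (a + b - 2) / (Gamma a * Gamma b)) *
      (\<integral>\<^sup>+u. ennreal (indicator {0..1} u * (u powr (b - 1) * (1 - u) powr (a - 1))) \<partial>lborel))"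
    by (subst nn_integral_cmult) auto
  also have "(\<integral>\<^sup>+u. ennreal (indicator {0..1} u * (u powr (b - 1) * (1 - u) powr (a - 1))) \<partial>lborel)
      = ennreal (Beta b a)"
    by (rule nn_integral_has_integral_lebesgue[OF _ has_integral_Beta_real[OF b a]]) auto
  also have "ennreal c * (ennreal (c powr (a + b - 2) / (Gamma a * Gamma b)) * ennreal (Beta b a))
      = ennreal (c * (c powr (a + b - 2) / (Gamma a * Gamma b) * Beta b a))"
  proof -
    have "0 \<le> c" "0 \<le> c powr (a + b - 2) / (Gamma a * Gamma b)" using c G by simp_all
    then show ?thesis by (simp only: ennreal_mult')
  qed
  also have "c * (c powr (a + b - 2) / (Gamma a * Gamma b) * Beta b a)
      = (c powr 1 * c powr (a + b - 2)) / Gamma (a + b)"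
    using c G by (simp add: Beta_def add.commute)
  also have "c powr 1 * c powr (a + b - 2) = c powr (a + b - 1)"
    by (subst powr_add[symmetric]) simp
  also have "c powr (a + b - 1) / Gamma (a + b) = fractional_kernel (a + b) (x - s)"
    using c by (simp add: fractional_kernel_def c_def)
  finally show ?thesis .
qed

lemma fractional_kernel_1: "fractional_kernel 1 t = indicator {0<..} t"
  by (simp add: fractional_kernel_def)

lemma fractional_kernel_bounded:
  assumes "1 \<le> c" "t \<le> 1"
  shows "fractional_kernel c t \<le> 1 / Gamma c"
proof (cases "0 < t")
  case True
  then have "t powr (c - 1) \<le> 1" using assms by (simp add: powr_le1)
  then show ?thesis using assms True by (simp add: fractional_kernel_def divide_right_mono)
qed (use assms in \<open>simp add: fractional_kernel_def\<close>)

text \<open>Since the kernel of order \<open>a + b \<ge> 1\<close> is bounded, Fubini applies at every \<open>x\<close>, not just almost everywhere.\<close>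

lemma fractional_convolution_compose:
  fixes f :: "real \<Rightarrow> real"
  assumes a: "0 < a" and b: "0 < b" and ab: "1 \<le> a + b" and x: "x \<le> 1"
    and f: "integrable lborel f" "\<And>t. t \<notin> {0<..<1} \<Longrightarrow> f t = 0"
  shows "integrable lborel (\<lambda>t. fractional_kernel a (x - t) * (LINT s|lborel. fractional_kernel b (t - s) * f s))"
    "(LINT t|lborel. fractional_kernel a (x - t) * (LINT s|lborel. fractional_kernel b (t - s) * f s))
      = (LINT s|lborel. fractional_kernel (a + b) (x - s) * f s)"
    "integrable lborel (\<lambda>s. fractional_kernel (a + b) (x - s) * f s)"
proof -
  let ?K = fractional_kernel
  have [measurable]: "f \<in> borel_measurable borel" using f(1) by simp
  let ?h = "\<lambda>(s, t). ?K a (x - t) * ?K b (t - s) * f s"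
  note nn = fractional_kernel_nonneg
  \<comment> \<open>Integrating out t first leaves the kernel of order a + b times the absolute
    value of f. Once this is known to be integrable, Tonelli makes \<open>?h\<close> integrable on
    the plane.\<close>
  have conv: "(\<integral>\<^sup>+t. ennreal (norm (?h (s, t))) \<partial>lborel) = ennreal (?K (a + b) (x - s) * \<bar>f s\<bar>)" for s
  proof -
    have "(\<integral>\<^sup>+t. ennreal (norm (?h (s, t))) \<partial>lborel)
      = (\<integral>\<^sup>+t. ennreal (?K a (x - t) * ?K b (t - s)) * ennreal \<bar>f s\<bar> \<partial>lborel)"
      using a b by (simp add: abs_mult nn ennreal_mult)
    also have "\<dots> = ennreal (?K (a + b) (x - s)) * ennreal \<bar>f s\<bar>"
      using a b by (subst nn_integral_multc) (auto simp: fractional_kernel_convolution)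
    finally show ?thesis using a b by (simp add: ennreal_mult nn)
  qed
  \<comment> \<open>Off (0, 1) both sides vanish together with f; for s in (0, 1) the argument x - s
    is at most 1, where a kernel of order at least 1 is bounded.\<close>
  have K: "?K (a + b) (x - s) * \<bar>f s\<bar> \<le> 1 / Gamma (a + b) * \<bar>f s\<bar>" for s
  proof (cases "s \<in> {0<..<1}")
    case True
    then show ?thesis using x ab by (intro mult_right_mono fractional_kernel_bounded) auto
  qed (simp add: f(2))
  show int: "integrable lborel (\<lambda>s. ?K (a + b) (x - s) * f s)"
  proof (rule Bochner_Integration.integrable_bound)
    show "integrable lborel (\<lambda>s. 1 / Gamma (a + b) * f s)" using f(1) by simp
    show "AE s in lborel. norm (?K (a + b) (x - s) * f s) \<le> norm (1 / Gamma (a + b) * f s)"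
      using K a b by (intro AE_I2) (auto simp: abs_mult nn Gamma_real_pos less_imp_le)
  qed measurable
  have "integrable (lborel \<Otimes>\<^sub>M lborel) ?h"
  proof (rule integrableI_bounded)
    have "(\<integral>\<^sup>+p. ennreal (norm (?h p)) \<partial>(lborel \<Otimes>\<^sub>M lborel)) = (\<integral>\<^sup>+s. \<integral>\<^sup>+t. ennreal (norm (?h (s, t))) \<partial>lborel \<partial>lborel)"
      by (subst lborel.nn_integral_fst) auto
    also have "\<dots> = (\<integral>\<^sup>+s. ennreal (norm (?K (a + b) (x - s) * f s)) \<partial>lborel)"
      unfolding conv using a b by (simp add: abs_mult nn)
    also have "\<dots> < \<infinity>" using int by (simp add: integrable_iff_bounded)
    finally show "(\<integral>\<^sup>+p. ennreal (norm (?h p)) \<partial>(lborel \<Otimes>\<^sub>M lborel)) < \<infinity>" .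
  qed measurable
  then have h: "integrable (lborel \<Otimes>\<^sub>M lborel) (case_prod (\<lambda>s t. ?K a (x - t) * ?K b (t - s) * f s))" .
  have inner: "(LINT s|lborel. ?K a (x - t) * ?K b (t - s) * f s) = ?K a (x - t) * (LINT s|lborel. ?K b (t - s) * f s)" for t
    by (simp add: mult.assoc)
  from lborel_pair.integrable_snd[OF h]
  show "integrable lborel (\<lambda>t. ?K a (x - t) * (LINT s|lborel. ?K b (t - s) * f s))"
    unfolding inner .
  have "(LINT t|lborel. ?K a (x - t) * (LINT s|lborel. ?K b (t - s) * f s))
    = (LINT s|lborel. LINT t|lborel. ?K a (x - t) * ?K b (t - s) * f s)"
    using lborel_pair.Fubini_integral[OF h] unfolding inner .
  also have "\<dots> = (LINT s|lborel. ?K (a + b) (x - s) * f s)"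
  proof (intro Bochner_Integration.integral_cong refl)
    fix s
    have "(LINT t|lborel. ?K a (x - t) * ?K b (t - s)) = ?K (a + b) (x - s)"
      using a b by (subst integral_eq_nn_integral) (auto simp: nn fractional_kernel_convolution)
    then show "(LINT t|lborel. ?K a (x - t) * ?K b (t - s) * f s) = ?K (a + b) (x - s) * f s" by simp
  qed
  finally show "(LINT t|lborel. ?K a (x - t) * (LINT s|lborel. ?K b (t - s) * f s))
      = (LINT s|lborel. ?K (a + b) (x - s) * f s)" .
qed

lemma fractional_kernel_convolution_integral:
  assumes "0 < a" "0 < b"
  shows "integrable lborel (\<lambda>t. fractional_kernel a (x - t) * fractional_kernel b (t - s))"
    "(LINT t|lborel. fractional_kernel a (x - t) * fractional_kernel b (t - s)) = fractional_kernel (a + b) (x - s)"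
proof -
  show "integrable lborel (\<lambda>t. fractional_kernel a (x - t) * fractional_kernel b (t - s))"
    using fractional_kernel_convolution[OF assms, of x s] assms
    by (intro integrableI_nonneg) (auto simp: fractional_kernel_nonneg)
  show "(LINT t|lborel. fractional_kernel a (x - t) * fractional_kernel b (t - s)) = fractional_kernel (a + b) (x - s)"
    using fractional_kernel_convolution[OF assms, of x s] assms
    by (subst integral_eq_nn_integral) (auto simp: fractional_kernel_nonneg)
qed

section \<open>Borel representatives of Lebesgue integrable functions\<close>

lemma borel_measurable_lebesgue_AE:
  fixes f g :: "real \<Rightarrow> real"
  assumes g: "g \<in> borel_measurable borel" and ae: "AE x in lborel. f x = g x"
  shows "f \<in> borel_measurable lebesgue"
proof (rule measurableI)
  fix A :: "real set" assume A: "A \<in> sets borel"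
  \<comment> \<open>Lebesgue measure is complete, so a set that agrees almost everywhere with a
    measurable one is measurable.\<close>
  have "AE x in lebesgue. x \<in> g -` A \<longleftrightarrow> x \<in> f -` A"
    using AE_completion[OF ae] by eventually_elim simp
  moreover have "g -` A \<in> sets lebesgue"
    using measurable_sets[OF g A] by (simp add: sets_completionI_sets)
  ultimately have "f -` A \<in> sets lebesgue"
    by (rule completion.in_sets_AE) simp
  then show "f -` A \<inter> space lebesgue \<in> sets lebesgue" by simp
qed simp

text \<open>Fubini needs functions measurable with respect to \<^term>\<open>lborel\<close>, hence the passage from \<open>f\<close> to \<open>f0\<close>.\<close>

definition borel_representative :: "(real \<Rightarrow> real) \<Rightarrow> (real \<Rightarrow> real) \<Rightarrow> bool" where
  "borel_representative f f0 \<longleftrightarrow> integrable lborel f0 \<and> (\<forall>t. t \<notin> {0<..<1} \<longrightarrow> f0 t = 0) \<and>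
     (AE t\<in>{0<..<1} in lborel. f t = f0 t)"

lemma borel_representativeD:
  assumes "borel_representative f f0"
  shows "integrable lborel f0" "\<And>t. t \<notin> {0<..<1} \<Longrightarrow> f0 t = 0" "AE t\<in>{0<..<1} in lborel. f t = f0 t"
    "f0 \<in> borel_measurable borel"
  using assms by (auto simp: borel_representative_def)

lemma L1_iff_borel_representative: "f \<in> L1 \<longleftrightarrow> (\<exists>f0. borel_representative f f0)"
proof
  assume "f \<in> L1"
  then have int: "integrable lebesgue (\<lambda>t. indicator {0<..<1} t * f t)"
    by (simp add: L1_def set_integrable_def)
  then obtain g where g: "g \<in> borel_measurable lborel" "AE t in lborel. indicator {0<..<1} t * f t = g t"
    using completion_ex_borel_measurable_real[of _ lborel] by blast
  let ?f0 = "\<lambda>t. indicator {0<..<1} t * g t"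
  have [measurable]: "g \<in> borel_measurable borel" using g(1) by simp
  have ae: "AE t in lborel. indicator {0<..<1} t * f t = ?f0 t"
    using g(2)
  proof eventually_elim
    case (elim t)
    then show ?case by (cases "t \<in> {0<..<1}") (simp_all del: greaterThanLessThan_iff)
  qed
  have "integrable lebesgue ?f0"
    using int AE_completion[OF ae] measurable_completion[of ?f0 lborel borel]
    by (subst integrable_cong_AE[symmetric, where f = "\<lambda>t. indicator {0<..<1} t * f t"]) auto
  then have "integrable lborel ?f0" by (subst (asm) integrable_completion) auto
  moreover have "AE t\<in>{0<..<1} in lborel. f t = ?f0 t"
    using ae by eventually_elim (auto simp: indicator_def)
  ultimately have "borel_representative f ?f0" by (auto simp: borel_representative_def)
  then show "\<exists>f0. borel_representative f f0" by blast
next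
  assume "\<exists>f0. borel_representative f f0"
  then obtain f0 where f0: "borel_representative f f0" by blast
  note [measurable] = borel_representativeD(4)[OF f0]
  have ae: "AE t in lborel. indicator {0<..<1} t * f t = f0 t"
    using borel_representativeD(3)[OF f0]
    by eventually_elim (use borel_representativeD(2)[OF f0] in \<open>auto simp: indicator_def\<close>)
  have "integrable lebesgue f0" using borel_representativeD(1)[OF f0] by (subst integrable_completion) auto
  then have "integrable lebesgue (\<lambda>t. indicator {0<..<1} t * f t)"
    using AE_completion[OF ae] borel_measurable_lebesgue_AE[OF _ ae]
    by (subst integrable_cong_AE[where g = f0]) auto
  then show "f \<in> L1" by (simp add: L1_def set_integrable_def)
qed

lemma set_integral_borel_representative:
  assumes f: "borel_representative f f0" and x: "x \<le> 1" and w[measurable]: "w \<in> borel_measurable borel"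
  shows "(LINT t:{0..x}|lebesgue. w t * f t) = (LINT t|lborel. indicator {..<x} t * w t * f0 t)"
proof -
  note [measurable] = borel_representativeD(4)[OF f]
  \<comment> \<open>The closed interval \<open>{0..x}\<close> and the open ray
    \<open>{..<x}\<close>, cut down to the support of \<open>f0\<close>, can differ only at the null
    points 0, 1 and x.\<close>
  have ne: "AE t in lborel. t \<noteq> c" for c :: real
    using AE_lborel_singleton[of c] by simp
  have ae: "AE t in lborel. indicator {0..x} t *\<^sub>R (w t * f t) = indicator {..<x} t * w t * f0 t"
    using borel_representativeD(3)[OF f] ne[of 0] ne[of 1] ne[of x]
    by eventually_elim (use borel_representativeD(2)[OF f] x in \<open>auto simp: indicator_def\<close>)
  have "(LINT t:{0..x}|lebesgue. w t * f t) = (LINT t|lebesgue. indicator {..<x} t * w t * f0 t)"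
    unfolding set_lebesgue_integral_def
    using AE_completion[OF ae] borel_measurable_lebesgue_AE[OF _ ae]
    by (intro integral_cong_AE) (auto intro!: measurable_completion)
  also have "\<dots> = (LINT t|lborel. indicator {..<x} t * w t * f0 t)"
    by (rule integral_completion) measurable
  finally show ?thesis .
qed

section \<open>Riemann-Liouville integrals as convolutions\<close>

lemma RL_integral_eq_convolution:
  assumes f: "borel_representative f f0" and x: "x \<le> 1" and b: "0 < b"
  shows "RL_integral b f x = (LINT t|lborel. fractional_kernel b (x - t) * f0 t)"
proof -
  have "(LINT t:{0..x}|lebesgue. (x - t) powr (b - 1) * f t)
      = (LINT t|lborel. indicator {..<x} t * (x - t) powr (b - 1) * f0 t)"
    by (rule set_integral_borel_representative[OF f x]) measurable
  then have "RL_integral b f x = (LINT t|lborel. 1 / Gamma b * (indicator {..<x} t * (x - t) powr (b - 1) * f0 t))"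
    using b by (simp add: RL_integral_def)
  also have "\<dots> = (LINT t|lborel. fractional_kernel b (x - t) * f0 t)"
    by (intro Bochner_Integration.integral_cong) (auto simp: fractional_kernel_def indicator_def)
  finally show ?thesis .
qed

lemma set_integral_eq_convolution:
  assumes f: "borel_representative f f0" and x: "x \<le> 1"
  shows "(LINT t:{0..x}|lebesgue. f t) = (LINT t|lborel. fractional_kernel 1 (x - t) * f0 t)"
  using set_integral_borel_representative[OF f x, of "\<lambda>_. 1"]
  by (simp add: fractional_kernel_1 indicator_def cong: if_cong)

lemma borel_representative_RL_integral:
  assumes f: "borel_representative f f0" and b: "0 < b"
  shows "borel_representative (RL_integral b f)
    (\<lambda>t. indicator {0<..<1} t * (LINT s|lborel. fractional_kernel b (t - s) * f0 s))"
proof -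
  \<comment> \<open>For t < 1 the kernel of order 1 has the value 1 at \<open>1 - t\<close>.
    Composing with it at the point 1 has total order above 1, which gives integrability on (0, 1)
    for every positive b.\<close>
  have "integrable lborel (\<lambda>t. indicator {0<..<1} t *\<^sub>R
      (fractional_kernel 1 (1 - t) * (LINT s|lborel. fractional_kernel b (t - s) * f0 s)))"
    using fractional_convolution_compose(1)[OF _ b, of 1 1 f0] borel_representativeD[OF f] b
    by (intro integrable_mult_indicator) auto
  also have "(\<lambda>t. indicator {0<..<1} t *\<^sub>R
      (fractional_kernel 1 (1 - t) * (LINT s|lborel. fractional_kernel b (t - s) * f0 s)))
    = (\<lambda>t. indicator {0<..<1} t * (LINT s|lborel. fractional_kernel b (t - s) * f0 s))"
    by (auto simp: fractional_kernel_1 indicator_def)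
  finally show ?thesis
    unfolding borel_representative_def
    using RL_integral_eq_convolution[OF f _ b] by (auto simp: indicator_def)
qed

lemma RL_integral_L1:
  assumes "f \<in> L1" "0 \<le> b"
  shows "RL_integral b f \<in> L1"
proof (cases "b = 0")
  case True
  then have "RL_integral b f = f" by (simp add: RL_integral_def fun_eq_iff)
  with assms show ?thesis by simp
next
  case False
  then show ?thesis
    using assms borel_representative_RL_integral[of f _ b] unfolding L1_iff_borel_representative
    by (metis less_eq_real_def)
qed

lemma convolution_eq_0:
  assumes "borel_representative f f0" "t \<le> 0"
  shows "(LINT s|lborel. fractional_kernel b (t - s) * f0 s) = 0"
proof -
  have *: "fractional_kernel b (t - s) * f0 s = 0" for s
    using borel_representativeD(2)[OF assms(1), of s] assms(2)
    by (cases "s \<in> {0<..<1}") (auto simp: fractional_kernel_def)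
  show ?thesis unfolding * by simp
qed

lemma RL_integral_compose:
  assumes f: "f \<in> L1" and a: "0 < a" and b: "0 \<le> b" and ab: "1 \<le> a + b" and x: "x \<le> 1"
  shows "RL_integral a (RL_integral b f) x = RL_integral (a + b) f x"
proof (cases "b = 0")
  case True
  then have "RL_integral b f = f" by (simp add: RL_integral_def fun_eq_iff)
  with True show ?thesis by simp
next
  case False
  with b have b: "0 < b" by simp
  obtain f0 where f0: "borel_representative f f0" using f L1_iff_borel_representative by blast
  have "RL_integral a (RL_integral b f) x = (LINT t|lborel. fractional_kernel a (x - t) *
      (indicator {0<..<1} t * (LINT s|lborel. fractional_kernel b (t - s) * f0 s)))"
    by (rule RL_integral_eq_convolution[OF borel_representative_RL_integral[OF f0 b] x a])
  \<comment> \<open>The indicator may be dropped: for t \<le> 0 the inner convolution vanishes, and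
    for t \<ge> 1 the outer kernel does, since x \<le> 1.\<close>
  also have "\<dots> = (LINT t|lborel. fractional_kernel a (x - t) * (LINT s|lborel. fractional_kernel b (t - s) * f0 s))"
    using x convolution_eq_0[OF f0]
    by (intro Bochner_Integration.integral_cong) (auto simp: indicator_def fractional_kernel_def not_less)
  also have "\<dots> = (LINT s|lborel. fractional_kernel (a + b) (x - s) * f0 s)"
    by (rule fractional_convolution_compose(2)[OF a b ab x borel_representativeD(1,2)[OF f0]])
  also have "\<dots> = RL_integral (a + b) f x"
    using a b by (intro RL_integral_eq_convolution[OF f0 x, symmetric]) simp
  finally show ?thesis .
qed

text \<open>On (0, 1) the constant c is c times the kernel of order 1, and the integral term is I^1
  \<phi>; convolution with the kernel of order a raises both orders by a. This is how a value at 0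
  becomes a power of x.\<close>

lemma RL_integral_primitive:
  assumes \<phi>: "\<phi> \<in> L1" and h: "AE x\<in>{0<..<1} in lebesgue. h x = c + (LINT t:{0..x}|lebesgue. \<phi> t)"
    and a: "0 < a" and x: "x \<le> 1"
  shows "RL_integral a h x = c * fractional_kernel (a + 1) x + RL_integral (a + 1) \<phi> x"
proof -
  let ?K = fractional_kernel
  obtain \<phi>0 where \<phi>0: "borel_representative \<phi> \<phi>0" using \<phi> L1_iff_borel_representative by blast
  define C where "C t = (LINT s|lborel. ?K 1 (t - s) * \<phi>0 s)" for t
  note compose = fractional_convolution_compose[OF _ zero_less_one _ _ borel_representativeD(1,2)[OF \<phi>0], folded C_def]
  have "integrable lborel (\<lambda>t. indicator {0<..<1} t *\<^sub>R (?K 1 (1 - t) * C t))"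
    by (intro integrable_mult_indicator compose) auto
  then have "integrable lborel (\<lambda>t. indicator {0<..<1} t *\<^sub>R c + indicator {0<..<1} t *\<^sub>R (?K 1 (1 - t) * C t))"
    by (intro Bochner_Integration.integrable_add) auto
  also have "(\<lambda>t. indicator {0<..<1} t *\<^sub>R c + indicator {0<..<1} t *\<^sub>R (?K 1 (1 - t) * C t))
    = (\<lambda>t. indicator {0<..<1} t * (c + C t))"
    by (auto simp: fractional_kernel_1 indicator_def)
  finally have "borel_representative h (\<lambda>t. indicator {0<..<1} t * (c + C t))"
    using h unfolding borel_representative_def AE_completion_iff
    by (auto elim!: eventually_mono simp: indicator_def C_def set_integral_eq_convolution[OF \<phi>0])
  then have "RL_integral a h x = (LINT t|lborel. ?K a (x - t) * (indicator {0<..<1} t * (c + C t)))"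
    by (rule RL_integral_eq_convolution[OF _ x a])
  also have "\<dots> = (LINT t|lborel. c * (?K a (x - t) * ?K 1 (t - 0)) + ?K a (x - t) * C t)"
    using x convolution_eq_0[OF \<phi>0, folded C_def]
    by (intro Bochner_Integration.integral_cong)
      (auto simp: indicator_def fractional_kernel_1 fractional_kernel_def not_less C_def algebra_simps)
  also have "\<dots> = c * ?K (a + 1) x + (LINT s|lborel. ?K (a + 1) (x - s) * \<phi>0 s)"
    using a x fractional_kernel_convolution_integral[OF a zero_less_one, of x 0] compose[OF a _ x]
    by (subst Bochner_Integration.integral_add) auto
  also have "(LINT s|lborel. ?K (a + 1) (x - s) * \<phi>0 s) = RL_integral (a + 1) \<phi> x"
    using a by (intro RL_integral_eq_convolution[OF \<phi>0 x, symmetric]) simp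
  finally show ?thesis .
qed

text \<open>The positive and negative parts of F are densities of two measures that are finite and
  equal on all rays, hence equal. Uniqueness of densities makes the parts equal almost everywhere,
  and as one of them is always 0, both vanish.\<close>

lemma AE_zero_of_ray_integrals_zero:
  fixes F :: "real \<Rightarrow> real"
  assumes F: "integrable lborel F" and zero: "\<And>x. (LINT t|lborel. indicator {x<..} t * F t) = 0"
  shows "AE t in lborel. F t = 0"
proof -
  have [measurable]: "F \<in> borel_measurable borel" using F by simp
  define P N where "P t = max 0 (F t)" and "N t = max 0 (- F t)" for t
  have [measurable]: "P \<in> borel_measurable borel" "N \<in> borel_measurable borel"
    unfolding P_def[abs_def] N_def[abs_def] by measurable
  have int: "integrable lborel P" "integrable lborel N"
    unfolding P_def[abs_def] N_def[abs_def] using F by auto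
  have int': "integrable lborel (\<lambda>t. indicator {x<..} t * P t)" "integrable lborel (\<lambda>t. indicator {x<..} t * N t)" for x
    using integrable_mult_indicator[OF _ int(1), of "{x<..}"] integrable_mult_indicator[OF _ int(2), of "{x<..}"]
    by simp_all
  have ray: "emeasure (density lborel (\<lambda>t. ennreal (P t))) {x<..} = ennreal (LINT t|lborel. indicator {x<..} t * P t)"
    "emeasure (density lborel (\<lambda>t. ennreal (N t))) {x<..} = ennreal (LINT t|lborel. indicator {x<..} t * N t)" for x
  proof -
    have "emeasure (density lborel (\<lambda>t. ennreal (P t))) {x<..} = (\<integral>\<^sup>+t. ennreal (indicator {x<..} t * P t) \<partial>lborel)"
      by (subst emeasure_density) (auto intro!: nn_integral_cong simp: indicator_def)
    also have "\<dots> = ennreal (LINT t|lborel. indicator {x<..} t * P t)"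
      by (rule nn_integral_eq_integral[OF int'(1)]) (auto simp: P_def)
    finally show "emeasure (density lborel (\<lambda>t. ennreal (P t))) {x<..} = \<dots>" .
    have "emeasure (density lborel (\<lambda>t. ennreal (N t))) {x<..} = (\<integral>\<^sup>+t. ennreal (indicator {x<..} t * N t) \<partial>lborel)"
      by (subst emeasure_density) (auto intro!: nn_integral_cong simp: indicator_def)
    also have "\<dots> = ennreal (LINT t|lborel. indicator {x<..} t * N t)"
      by (rule nn_integral_eq_integral[OF int'(2)]) (auto simp: N_def)
    finally show "emeasure (density lborel (\<lambda>t. ennreal (N t))) {x<..} = \<dots>" .
  qed
  have "density lborel (\<lambda>t. ennreal (P t)) = density lborel (\<lambda>t. ennreal (N t))"
  proof (rule measure_eqI_lessThan)
    fix x :: real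
    have "(LINT t|lborel. indicator {x<..} t * P t) - (LINT t|lborel. indicator {x<..} t * N t)
      = (LINT t|lborel. indicator {x<..} t * P t - indicator {x<..} t * N t)"
      by (rule Bochner_Integration.integral_diff[symmetric]) (rule int')+
    also have "\<dots> = (LINT t|lborel. indicator {x<..} t * F t)"
      by (intro Bochner_Integration.integral_cong) (auto simp: P_def N_def indicator_def)
    finally show "emeasure (density lborel (\<lambda>t. ennreal (P t))) {x<..} = emeasure (density lborel (\<lambda>t. ennreal (N t))) {x<..}"
      using zero[of x] by (simp add: ray)
    show "emeasure (density lborel (\<lambda>t. ennreal (P t))) {x<..} < \<infinity>" by (simp add: ray)
  qed auto
  then have "AE t in lborel. ennreal (P t) = ennreal (N t)"
    by (subst (asm) sigma_finite_measure.density_unique_iff[OF sigma_finite_lborel]) auto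
  then show ?thesis
    by eventually_elim (auto simp: P_def N_def max_def split: if_splits)
qed

section \<open>The projector\<close>

text \<open>An absolutely continuous representative exists and has a density, so the choices
  \<open>AC_representative\<close> and \<open>AC_deriv\<close> both satisfy the properties by which
  they are chosen.\<close>

lemma AC_fundamental_theorem:
  assumes "h \<in> AC"
  shows "AC_deriv h \<in> L1"
    "AE x\<in>{0<..<1} in lebesgue. h x = AC_representative h 0 + (LINT t:{0..x}|lebesgue. AC_deriv h t)"
proof -
  have rep: "is_AC_representative h (AC_representative h)"
    using assms someI_ex[of "is_AC_representative h"] by (simp add: AC_def AC_representative_def)
  let ?g = "AC_representative h"
  have "absolutely_continuous_fun_on 0 1 ?g" using rep by (simp add: is_AC_representative_def)
  then obtain \<phi> where \<phi>: "set_integrable lborel {0..1} \<phi>"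
    "\<And>x. x \<in> {0..1} \<Longrightarrow> ?g x = ?g 0 + (LINT t:{0..x}|lborel. \<phi> t)"
    using absolutely_continuous_fun_density by blast
  have Ioo: "set_integrable lborel {0<..<1} \<phi>"
    by (rule set_integrable_subset[OF \<phi>(1)]) auto
  then have "\<phi> \<in> L1"
    unfolding L1_def set_integrable_def mem_Collect_eq by (subst integrable_completion) auto
  moreover have "?g x = ?g 0 + (LINT t:{0..x}|lebesgue. \<phi> t)" if x: "x \<in> {0..1}" for x
  proof -
    have "set_integrable lborel {0..x} \<phi>"
      by (rule set_integrable_subset[OF \<phi>(1)]) (use x in auto)
    then have "(LINT t:{0..x}|lebesgue. \<phi> t) = (LINT t:{0..x}|lborel. \<phi> t)"
      unfolding set_lebesgue_integral_def set_integrable_def by (intro integral_completion) auto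
    with \<phi>(2)[OF x] show ?thesis by simp
  qed
  ultimately have "\<phi> \<in> L1 \<and> (\<forall>x\<in>{0..1}. ?g x = ?g 0 + (LINT t:{0..x}|lebesgue. \<phi> t))" by blast
  then have deriv: "AC_deriv h \<in> L1 \<and> (\<forall>x\<in>{0..1}. ?g x = ?g 0 + (LINT t:{0..x}|lebesgue. AC_deriv h t))"
    unfolding AC_deriv_def
    by (rule someI[of "\<lambda>\<phi>. \<phi> \<in> L1 \<and> (\<forall>x\<in>{0..1}. ?g x = ?g 0 + (LINT t:{0..x}|lebesgue. \<phi> t))"])
  then show "AC_deriv h \<in> L1" by blast
  have "AE x\<in>{0<..<1} in lebesgue. h x = ?g x" using rep by (simp add: is_AC_representative_def)
  then show "AE x\<in>{0<..<1} in lebesgue. h x = ?g 0 + (LINT t:{0..x}|lebesgue. AC_deriv h t)"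
  proof eventually_elim
    case (elim x)
    show ?case
    proof
      assume x: "x \<in> {0<..<1}"
      then have "x \<in> {0..1}" by simp
      have "h x = ?g x" using x elim by blast
      also have "\<dots> = ?g 0 + (LINT t:{0..x}|lebesgue. AC_deriv h t)"
        using deriv \<open>x \<in> {0..1}\<close> by blast
      finally show "h x = ?g 0 + (LINT t:{0..x}|lebesgue. AC_deriv h t)" .
    qed
  qed
qed

lemma RL_deriv_prod_step:
  assumes "k \<le> n"
  shows "RL_deriv_prod \<gamma> k n h = RL_integral (\<gamma> k) (AC_deriv (RL_deriv_prod \<gamma> (Suc k) n h))"
proof -
  have "[k..<Suc n] = k # [Suc k..<Suc n]" using assms by (simp add: upt_conv_Cons)
  then show ?thesis by (simp add: RL_deriv_prod_def del: upt_Suc)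
qed

text \<open>This differentiates an identity between primitives: the difference F of the two
  integrands has integral 0 over every ray and is therefore 0 almost everywhere. The condition 0 <
  \<sigma> k makes the kernels integrable near 0.\<close>

lemma AE_eq_of_RL_integral_1_eq:
  assumes f: "f \<in> L1" and g: "g \<in> L1" and \<sigma>: "\<And>k. k \<in> A \<Longrightarrow> 0 < \<sigma> k"
    and eq: "\<And>x. x \<le> 1 \<Longrightarrow> RL_integral 1 f x =
      (\<Sum>k\<in>A. c k * fractional_kernel (\<sigma> k + 1) x) + RL_integral 1 g x"
  shows "AE x\<in>{0<..<1} in lebesgue. f x - g x = (\<Sum>k\<in>A. c k * fractional_kernel (\<sigma> k) x)"
proof -
  let ?K = fractional_kernel
  obtain f0 where f0: "borel_representative f f0" using f L1_iff_borel_representative by blast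
  obtain g0 where g0: "borel_representative g g0" using g L1_iff_borel_representative by blast
  \<comment> \<open>The factor \<open>?K 1 (1 - t)\<close> cuts the powers off at t = 1, so that p
    vanishes outside (0, 1) like f0 and g0, and F is integrable on the line.\<close>
  define p where "p t = (\<Sum>k\<in>A. c k * (?K 1 (1 - t) * ?K (\<sigma> k) t))" for t
  define F where "F t = f0 t - g0 t - p t" for t
  have p_int: "integrable lborel (\<lambda>t. ?K 1 (x - t) * p t)"
    "(LINT t|lborel. ?K 1 (x - t) * p t) = (\<Sum>k\<in>A. c k * ?K (\<sigma> k + 1) x)" if "x \<le> 1" for x
  proof -
    have p: "(\<lambda>t. ?K 1 (x - t) * p t) = (\<lambda>t. \<Sum>k\<in>A. c k * (?K 1 (x - t) * ?K (\<sigma> k) (t - 0)))"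
      using that by (auto simp: p_def fractional_kernel_1 sum_distrib_left indicator_def intro!: sum.cong)
    note conv = fractional_kernel_convolution_integral[OF zero_less_one \<sigma>, of _ x 0]
    show "integrable lborel (\<lambda>t. ?K 1 (x - t) * p t)"
      unfolding p using conv(1) by (intro Bochner_Integration.integrable_sum integrable_mult_right) auto
    show "(LINT t|lborel. ?K 1 (x - t) * p t) = (\<Sum>k\<in>A. c k * ?K (\<sigma> k + 1) x)"
      unfolding p using conv by (subst Bochner_Integration.integral_sum) (auto simp: add.commute intro!: sum.cong)
  qed
  have F_outside: "F t = 0" if "t \<notin> {0<..<1}" for t
    using that borel_representativeD(2)[OF f0 that] borel_representativeD(2)[OF g0 that]
    by (auto simp: F_def p_def fractional_kernel_def)
  have p1: "?K 1 (1 - t) * p t = p t" for t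
    by (auto simp: p_def fractional_kernel_1 indicator_def)
  have F_int: "integrable lborel F"
    unfolding F_def using borel_representativeD(1)[OF f0] borel_representativeD(1)[OF g0] p_int(1)[of 1, unfolded p1]
    by (intro Bochner_Integration.integrable_diff) auto
  have F_zero: "(LINT t|lborel. ?K 1 (x - t) * F t) = 0" if x: "x \<le> 1" for x
  proof -
    have int: "integrable lborel (\<lambda>t. ?K 1 (x - t) * h t)" if "integrable lborel h" for h :: "real \<Rightarrow> real"
    proof -
      have "integrable lborel (\<lambda>t. indicator {..<x} t *\<^sub>R h t)" using that by (intro integrable_mult_indicator) auto
      also have "(\<lambda>t. indicator {..<x} t *\<^sub>R h t) = (\<lambda>t. ?K 1 (x - t) * h t)"
        by (auto simp: fractional_kernel_1 indicator_def)
      finally show ?thesis .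
    qed
    note i = int[OF borel_representativeD(1)[OF f0]] int[OF borel_representativeD(1)[OF g0]] p_int(1)[OF x]
    have "(LINT t|lborel. ?K 1 (x - t) * F t)
      = (LINT t|lborel. ?K 1 (x - t) * f0 t - ?K 1 (x - t) * g0 t - ?K 1 (x - t) * p t)"
      by (simp add: F_def right_diff_distrib)
    also have "\<dots> = RL_integral 1 f x - RL_integral 1 g x - (\<Sum>k\<in>A. c k * ?K (\<sigma> k + 1) x)"
      using i p_int(2)[OF x] RL_integral_eq_convolution[OF f0 x zero_less_one]
        RL_integral_eq_convolution[OF g0 x zero_less_one]
      by simp
    finally show ?thesis using eq[OF x] by simp
  qed
  have "AE t in lborel. F t = 0"
  proof (rule AE_zero_of_ray_integrals_zero[OF F_int])
    fix x :: real
    \<comment> \<open>The integral over \<open>{x<..}\<close> is the total one minus that over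
      \<open>{..<y}\<close>. The minimum keeps y in the range of \<open>F_zero\<close>, and F
      vanishes from 1 on.\<close>
    define y where "y = min 1 x"
    have "integrable lborel (\<lambda>t. indicator {..<y} t *\<^sub>R F t)" using F_int by (intro integrable_mult_indicator) auto
    also have "(\<lambda>t. indicator {..<y} t *\<^sub>R F t) = (\<lambda>t. ?K 1 (y - t) * F t)"
      by (auto simp: fractional_kernel_1 indicator_def)
    finally have i: "integrable lborel (\<lambda>t. ?K 1 (y - t) * F t)" .
    have "AE t in lborel. t \<noteq> x" using AE_lborel_singleton[of x] by simp
    then have ae: "AE t in lborel. indicator {x<..} t * F t = F t - ?K 1 (y - t) * F t"
      by eventually_elim (use F_outside in \<open>auto simp: y_def fractional_kernel_1 indicator_def min_def\<close>)
    have [measurable]: "F \<in> borel_measurable borel" using F_int by simp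
    have "(LINT t|lborel. indicator {x<..} t * F t) = (LINT t|lborel. F t - ?K 1 (y - t) * F t)"
      by (rule integral_cong_AE[OF _ _ ae]) measurable
    also have "\<dots> = (LINT t|lborel. F t) - (LINT t|lborel. ?K 1 (y - t) * F t)"
      using F_int i by (rule Bochner_Integration.integral_diff)
    also have "(LINT t|lborel. F t) = (LINT t|lborel. ?K 1 (1 - t) * F t)"
      by (intro Bochner_Integration.integral_cong) (use F_outside in \<open>auto simp: fractional_kernel_1 indicator_def\<close>)
    finally show "(LINT t|lborel. indicator {x<..} t * F t) = 0"
      using F_zero[of 1] F_zero[of y] by (simp add: y_def)
  qed
  then have "AE t\<in>{0<..<1} in lborel. f t - g t = (\<Sum>k\<in>A. c k * ?K (\<sigma> k) t)"
    using borel_representativeD(3)[OF f0] borel_representativeD(3)[OF g0]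
    by eventually_elim (auto simp: F_def p_def fractional_kernel_1)
  then show ?thesis by (rule AE_completion)
qed

theorem theorem2p2:
  fixes n :: nat and \<alpha> :: real and \<gamma> :: "nat \<Rightarrow> real"
  assumes "n \<ge> 1"
    and "0 < \<alpha>" and "\<alpha> \<le> 1"
    and "\<And>k. k \<in> {1..n} \<Longrightarrow> 0 \<le> \<gamma> k"
    and "\<And>k. k \<in> {1..n} \<Longrightarrow> \<alpha> + partial_type_sum \<gamma> k \<le> real k"
    and "real n - 1 < \<alpha> + partial_type_sum \<gamma> n"
    and "\<And>k. k \<in> {2..n} \<Longrightarrow> \<gamma> k < 1"
  shows "\<forall>f\<in>nL_domain n \<alpha> \<gamma>. AE x\<in>{0<..<1} in lebesgue.
    nL_projector n \<alpha> \<gamma> f x = (\<Sum>k=1..n. nL_coefficient n \<alpha> \<gamma> f k * x powr nL_exponent \<alpha> \<gamma> k)"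
proof
  fix f assume f: "f \<in> nL_domain n \<alpha> \<gamma>"
  \<comment> \<open>\<open>b n\<close> is the order of the inner integral, and - b k is the exponent
    \<sigma>_k, so the kernel of order 1 - b k is x to the power \<sigma>_k divided by Gamma
    (\<sigma>_k + 1).\<close>
  define b where "b k = real k - \<alpha> - partial_type_sum \<gamma> k" for k
  \<comment> \<open>The index is that of the leftmost factor: \<open>H 1\<close> is the whole
    derivative, \<open>H (Suc n)\<close> the inner integral, and the value of
    \<open>H (Suc k)\<close> at 0 the numerator of p_k.\<close>
  define H where "H k = RL_deriv_prod \<gamma> k n (inner_integral n \<alpha> \<gamma> f)" for k
  define c where "c k = AC_representative (H (Suc k)) 0" for k
  let ?K = fractional_kernel
  have f_L1: "f \<in> L1" using f by (simp add: nL_domain_def)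
  have H_AC: "H (Suc k) \<in> AC" if "k \<in> {1..n}" for k
    using f that unfolding nL_domain_def H_def by auto
  have H_step: "H k = RL_integral (\<gamma> k) (AC_deriv (H (Suc k)))" if "k \<le> n" for k
    unfolding H_def using RL_deriv_prod_step[OF that] .
  have H_top: "H (Suc n) = RL_integral (b n) f"
    by (simp add: H_def RL_deriv_prod_def inner_integral_def b_def)
  have b_0: "b 0 = - \<alpha>" by (simp add: b_def partial_type_sum_def)
  have b_Suc: "b (Suc k) = b k + 1 - \<gamma> (Suc k)" for k by (simp add: b_def partial_type_sum_def)
  \<comment> \<open>Going down from n, b k = b (k + 1) - 1 + \<gamma> (k + 1) stays below b (k + 1)
    while \<gamma> (k + 1) < 1. That bound is assumed from index 2 on; b 0 = - \<alpha> is treated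
    directly.\<close>
  have b_less: "b k < 1" if "k \<le> n" for k
    using that
  proof (induction k rule: inc_induct)
    case base
    show ?case using assms(6) by (simp add: b_def)
  next
    case (step k)
    show ?case
    proof (cases "k = 0")
      case True
      then show ?thesis using b_0 assms(2) by simp
    next
      case False
      then have "\<gamma> (Suc k) < 1" using step.hyps by (intro assms(7)) auto
      then show ?thesis using step.IH b_Suc[of k] by simp
    qed
  qed
  have step: "RL_integral (1 - b (Suc k)) (H (Suc (Suc k))) x
      = c (Suc k) * ?K (2 - b (Suc k)) x + RL_integral (1 - b k) (H (Suc k)) x"
    if k: "Suc k \<le> n" and x: "x \<le> 1" for k x
  proof -
    let ?\<phi> = "AC_deriv (H (Suc (Suc k)))"
    have AC: "H (Suc (Suc k)) \<in> AC" using k by (intro H_AC) auto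
    note ftc = AC_fundamental_theorem[OF AC]
    have pos: "0 < 1 - b k" "0 < 1 - b (Suc k)" using b_less[of k] b_less[of "Suc k"] k by auto
    have \<gamma>: "0 \<le> \<gamma> (Suc k)" using k by (intro assms(4)) auto
    \<comment> \<open>Writing \<open>H (Suc (Suc k))\<close> as a primitive raises the order by 1.
      Of the new total, the part \<gamma> (k + 1) rebuilds \<open>H (Suc k)\<close> and 1 - b k is
      left over. The total exceeds 1 because b (k + 1) < 1, as the pointwise semigroup law
      requires.\<close>
    have order: "1 - b (Suc k) + 1 = 1 - b k + \<gamma> (Suc k)" using b_Suc[of k] by simp
    have "RL_integral (1 - b (Suc k)) (H (Suc (Suc k))) x
      = c (Suc k) * ?K (1 - b (Suc k) + 1) x + RL_integral (1 - b (Suc k) + 1) ?\<phi> x"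
      unfolding c_def by (rule RL_integral_primitive[OF ftc pos(2) x])
    also have "RL_integral (1 - b (Suc k) + 1) ?\<phi> x = RL_integral (1 - b k) (RL_integral (\<gamma> (Suc k)) ?\<phi>) x"
      unfolding order using pos order by (intro RL_integral_compose[OF ftc(1) pos(1) \<gamma> _ x, symmetric]) linarith
    finally show ?thesis using H_step[OF k] by simp
  qed
  have telescope: "RL_integral (1 - b m) (H (Suc m)) x
      = (\<Sum>k=1..m. c k * ?K (2 - b k) x) + RL_integral (1 - b 0) (H 1) x"
    if "m \<le> n" "x \<le> 1" for m x
    using that by (induction m) (simp_all add: step)
  have H1: "H 1 \<in> L1"
    using H_step[OF assms(1)] AC_fundamental_theorem(1)[OF H_AC[of 1]] assms(1,4)
    by (auto intro: RL_integral_L1)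
  have "AE x\<in>{0<..<1} in lebesgue. f x - RL_integral \<alpha> (H 1) x = (\<Sum>k=1..n. c k * ?K (1 - b k) x)"
  proof (rule AE_eq_of_RL_integral_1_eq[OF f_L1])
    show "RL_integral \<alpha> (H 1) \<in> L1" using H1 assms(2) by (intro RL_integral_L1) auto
    show "0 < 1 - b k" if "k \<in> {1..n}" for k using b_less that by simp
    fix x :: real assume x: "x \<le> 1"
    have bn: "0 \<le> b n" "0 < 1 - b n" using assms(1) assms(5)[of n] b_less[of n] by (auto simp: b_def)
    \<comment> \<open>The orders 1 - b n and b n add up to exactly 1, the least total order that the
      pointwise law admits; hence the identity is first obtained for I^1 f and not for f.\<close>
    have "RL_integral 1 f x = RL_integral (1 - b n) (RL_integral (b n) f) x"
      using RL_integral_compose[OF f_L1 bn(2,1) _ x] by simp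
    also have "\<dots> = (\<Sum>k=1..n. c k * ?K (2 - b k) x) + RL_integral (1 + \<alpha>) (H 1) x"
      using telescope[OF order_refl x] by (simp add: H_top b_0)
    also have "RL_integral (1 + \<alpha>) (H 1) x = RL_integral 1 (RL_integral \<alpha> (H 1)) x"
      using assms(2) by (intro RL_integral_compose[OF H1 _ _ _ x, symmetric]) auto
    also have "(\<lambda>k. 2 - b k) = (\<lambda>k. 1 - b k + 1)" by auto
    finally show "RL_integral 1 f x = (\<Sum>k=1..n. c k * ?K (1 - b k + 1) x) + RL_integral 1 (RL_integral \<alpha> (H 1)) x" .
  qed
  then show "AE x\<in>{0<..<1} in lebesgue.
    nL_projector n \<alpha> \<gamma> f x = (\<Sum>k=1..n. nL_coefficient n \<alpha> \<gamma> f k * x powr nL_exponent \<alpha> \<gamma> k)"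
  proof eventually_elim
    case (elim x)
    have "c k * ?K (1 - b k) x = nL_coefficient n \<alpha> \<gamma> f k * x powr nL_exponent \<alpha> \<gamma> k" if "0 < x" for k
      using that by (simp add: fractional_kernel_def nL_coefficient_def nL_exponent_def c_def H_def b_def algebra_simps)
    with elim show ?case by (simp add: nL_projector_def nL_derivative_def H_def)
  qed
qed

end
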